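(* For any $\epsilon>0$, $d\geq 1$ and $k\geq 2$, there exists a one-sided error $\epsilon$-tester for $k$-EQU (in the bounded-degree model with degree bound $d$) with query complexity $O(n^{1/2}\,\mathrm{poly}(dk\log n/\epsilon))$, where $n$ is the number of variables.
   Context: $k$-EQU is the predicate $\{0,1\}^k\to\{0,1\}$ satisfied iff all $k$ inputs are equal; an instance of $k$-EQU consists of Boolean variables and constraints, each on a $k$-tuple of variables $(x_1,\dots,x_k)$ and of the form $k\text{-EQU}(x_1+b_1,\dots,x_k+b_k)=1$ for some $b\in\{0,1\}^k$ (addition mod 2). Bounded-degree model with degree bound $d$: each variable appears in at most $d$ constraints; an algorithm accesses the instance only via an oracle that, given a variable $x$ and an index $1\le i\le d$, returns the $i$-th constraint containing $x$ (or a special symbol if none exists); query complexity is the number of oracle calls. An instance is $\epsilon$-far from satisfiability if at least $\epsilon dn/k$ constraints must be removed to make it satisfiable. An $\epsilon$-tester is a randomized algorithm that accepts every satisfiable instance with probability at least $2/3$ and rejects every instance $\epsilon$-far from satisfiability with probability at least $2/3$; it is one-sided error if it accepts every satisfiable instance with probability $1$. *)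

theory Defs
  imports "HOL-Probability.Probability" "HOL-Library.Z2"
    "HOL-Computational_Algebra.Polynomial"
begin

definition equ :: "nat \<Rightarrow> bit list \<Rightarrow> bool" where
  "equ k ys \<longleftrightarrow> length ys = k \<and> (\<forall>y\<in>set ys. \<forall>z\<in>set ys. y = z)"

text \<open>The constraint \<open>k-EQU(x1 + b1, ..., xk + bk) = 1\<close> is the list
  \<open>[(x1, b1), ..., (xk, bk)]\<close>. Its variables need not be pairwise distinct.\<close>

type_synonym equ_constraint = "(nat \<times> bit) list"

definition constraint_vars :: "equ_constraint \<Rightarrow> nat set" where
  "constraint_vars c = fst ` set c"

definition sat_constraint :: "nat \<Rightarrow> (nat \<Rightarrow> bit) \<Rightarrow> equ_constraint \<Rightarrow> bool" where
  "sat_constraint k \<sigma> c \<longleftrightarrow> equ k (map (\<lambda>(x, b). \<sigma> x + b) c)"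

text \<open>Constraints are identified by their position in \<^term>\<open>constrs\<close>, so the same constraint may
  occur several times. The list \<^term>\<open>incident\<close> fixes, separately for every variable and in an
  arbitrary order, the numbering of the constraints containing that variable which the oracle
  uses.\<close>

record equ_inst =
  constrs :: "equ_constraint list"
  incident :: "nat \<Rightarrow> nat list"

text \<open>Instances on the variables \<open>0, ..., n - 1\<close> with degree bound \<open>d\<close>.\<close>

definition equ_insts :: "nat \<Rightarrow> nat \<Rightarrow> nat \<Rightarrow> equ_inst set" where
  "equ_insts k d n = {I.
     (\<forall>c\<in>set (constrs I). length c = k \<and> constraint_vars c \<subseteq> {..<n}) \<and>
     (\<forall>x. distinct (incident I x) \<and>
          set (incident I x) = {j. j < length (constrs I) \<and> x \<in> constraint_vars (constrs I ! j)} \<and>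
          length (incident I x) \<le> d)}"

definition satisfiable_without :: "nat \<Rightarrow> nat set \<Rightarrow> equ_inst \<Rightarrow> bool" where
  "satisfiable_without k R I \<longleftrightarrow>
     (\<exists>\<sigma>. \<forall>j<length (constrs I). j \<notin> R \<longrightarrow> sat_constraint k \<sigma> (constrs I ! j))"

definition satisfiable :: "nat \<Rightarrow> equ_inst \<Rightarrow> bool" where
  "satisfiable k I \<longleftrightarrow> satisfiable_without k {} I"

definition eps_far :: "real \<Rightarrow> nat \<Rightarrow> nat \<Rightarrow> nat \<Rightarrow> equ_inst \<Rightarrow> bool" where
  "eps_far \<epsilon> k d n I \<longleftrightarrow>
     (\<forall>R \<subseteq> {..<length (constrs I)}.
        satisfiable_without k R I \<longrightarrow> real (card R) \<ge> \<epsilon> * real d * real n / real k)"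

text \<open>Indices are numbered from 1. Queries with an index outside \<open>1, ..., d\<close> or a variable outside
  \<open>0, ..., n - 1\<close> are answered by \<^term>\<open>None\<close> and hence reveal nothing.\<close>

definition equ_oracle :: "equ_inst \<Rightarrow> nat \<Rightarrow> nat \<Rightarrow> equ_constraint option" where
  "equ_oracle I x i =
     (if 1 \<le> i \<and> i \<le> length (incident I x)
      then Some (constrs I ! (incident I x ! (i - 1))) else None)"

text \<open>A randomized adaptive query algorithm: it outputs its verdict (accept = \<^term>\<open>True\<close>), draws
  a fresh random number, or calls the oracle, and continues depending on the result.\<close>

datatype query_alg =
    Verdict bool
  | Sample "nat pmf" "nat \<Rightarrow> query_alg"
  | Query nat nat "equ_constraint option \<Rightarrow> query_alg"

text \<open>The joint distribution of the verdict and the number of oracle calls made.\<close>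

primrec run_alg ::
  "(nat \<Rightarrow> nat \<Rightarrow> equ_constraint option) \<Rightarrow> query_alg \<Rightarrow> (bool \<times> nat) pmf" where
  "run_alg orc (Verdict b) = return_pmf (b, 0)"
| "run_alg orc (Sample p f) = bind_pmf p (\<lambda>r. run_alg orc (f r))"
| "run_alg orc (Query x i f) = map_pmf (\<lambda>(b, q). (b, Suc q)) (run_alg orc (f (orc x i)))"

definition prob_accept :: "query_alg \<Rightarrow> equ_inst \<Rightarrow> real" where
  "prob_accept A I = measure_pmf.prob (run_alg (equ_oracle I) A) {(b, q). b}"

definition prob_reject :: "query_alg \<Rightarrow> equ_inst \<Rightarrow> real" where
  "prob_reject A I = measure_pmf.prob (run_alg (equ_oracle I) A) {(b, q). \<not> b}"

definition eps_tester :: "real \<Rightarrow> nat \<Rightarrow> nat \<Rightarrow> nat \<Rightarrow> query_alg \<Rightarrow> bool" where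
  "eps_tester \<epsilon> k d n A \<longleftrightarrow>
     (\<forall>I\<in>equ_insts k d n.
        (satisfiable k I \<longrightarrow> prob_accept A I \<ge> 2/3) \<and>
        (eps_far \<epsilon> k d n I \<longrightarrow> prob_reject A I \<ge> 2/3))"

definition one_sided :: "nat \<Rightarrow> nat \<Rightarrow> nat \<Rightarrow> query_alg \<Rightarrow> bool" where
  "one_sided k d n A \<longleftrightarrow> (\<forall>I\<in>equ_insts k d n. satisfiable k I \<longrightarrow> prob_accept A I = 1)"

text \<open>Worst case over all instances and all random choices.\<close>

definition query_complexity_le :: "nat \<Rightarrow> nat \<Rightarrow> nat \<Rightarrow> query_alg \<Rightarrow> real \<Rightarrow> bool" where
  "query_complexity_le k d n A B \<longleftrightarrow>
     (\<forall>I\<in>equ_insts k d n. \<forall>(b, q)\<in>set_pmf (run_alg (equ_oracle I) A). real q \<le> B)"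

end

theory Submission
  imports Defs
begin

text \<open>
  Parity is tracked by a random walk on the double cover of the constraint hypergraph: from \<open>(u, a)\<close>
  pick a random constraint at \<open>u\<close>, a random variable \<open>v\<close> of it, and add to \<open>a\<close> the relative sign of
  \<open>u\<close> and \<open>v\<close>. Two walks from \<open>s\<close> that end in the same variable with different parities exhibit an
  unsatisfiable set of constraints, and by the birthday paradox \<open>O(sqrt n)\<close> walks of length \<open>l\<close>
  contain such a pair as soon as the two parity classes of the end point distribution overlap in
  constant mass.

  The walk has a uniform stationary distribution, so the entropy of its \<open>l\<close>-step distribution,
  averaged over the start, is nondecreasing in \<open>l\<close> and at most \<open>ln (2 n)\<close>. Hence some \<open>l\<close> of
  polylogarithmic size has almost no increase, which means that the \<open>l\<close>-step distributions from the
  variables of a typical constraint are close in \<open>L1\<close>. If the parity overlap is small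
  at almost all variables, then the vectors of parity biases \<open>p (s, 0) - p (s, 1)\<close> have \<open>L1\<close>-norm
  bounded below, and rounding them (repeatedly pick a coordinate \<open>s\<close> and a threshold, and assign
  to the variables whose bias exceeds the threshold its sign) gives an assignment that violates
  few constraints. So an instance that is far from satisfiable has many start variables with large
  overlap.
\<close>

subsection \<open>Entropy of doubly stochastic walks\<close>

text \<open>A pointwise form of Pinsker's inequality. With \<open>a = sqrt p\<close>,
  \<open>b = sqrt q\<close>, the bound \<open>ln x \<le> x - 1\<close> controls
  \<open>(a - b)\<^sup>2\<close> by the entropy term, and weighted AM-GM with the free parameter
  \<open>\<alpha>\<close> splits \<open>\<bar>a - b\<bar> * (a + b)\<close>. The result is linear in
  the entropy term, so it can be summed and averaged directly; the extra \<open>- p + q\<close>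
  cancels for probability vectors.\<close>

lemma abs_diff_le_relative_entropy:
  fixes p q \<alpha> :: real
  assumes "0 \<le> p" "0 \<le> q" "0 < p \<Longrightarrow> 0 < q" "0 < \<alpha>"
  shows "\<bar>p - q\<bar> \<le> (p * ln p - p * ln q - p + q) / (2 * \<alpha>) + \<alpha> * (p + q)"
proof -
  define a b where "a = sqrt p" and "b = sqrt q"
  have ab: "0 \<le> a" "0 \<le> b" "p = a\<^sup>2" "q = b\<^sup>2"
    using assms by (auto simp: a_def b_def)
  have KL: "(a - b)\<^sup>2 \<le> p * ln p - p * ln q - p + q"
  proof (cases "p = 0")
    case True
    then show ?thesis using ab by simp
  next
    case False
    then have pos: "0 < a" "0 < b" using assms ab by (auto simp: less_le)
    have "ln (b / a) \<le> b / a - 1" using pos by (intro ln_le_minus_one) auto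
    then have "a\<^sup>2 * (ln b - ln a) \<le> a\<^sup>2 * (b / a - 1)"
      using pos by (intro mult_left_mono) (auto simp: ln_div)
    also have "\<dots> = a * b - a\<^sup>2" using pos by (simp add: field_simps power2_eq_square)
    finally have "2 * (a\<^sup>2 * ln b - a\<^sup>2 * ln a) \<le> 2 * (a * b - a\<^sup>2)" by (simp add: algebra_simps)
    moreover have "ln p = 2 * ln a" "ln q = 2 * ln b" using pos ab by (auto simp: ln_realpow)
    ultimately show ?thesis using ab by (simp add: power2_eq_square algebra_simps)
  qed
  have "\<bar>p - q\<bar> = \<bar>a - b\<bar> * (a + b)"
    using ab by (simp add: power2_eq_square square_diff_square_factored abs_mult)
  also have "\<dots> \<le> (a - b)\<^sup>2 / (2 * \<alpha>) + \<alpha> / 2 * (a + b)\<^sup>2"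
  proof -
    have "x * y \<le> x\<^sup>2 / (2 * \<alpha>) + \<alpha> / 2 * y\<^sup>2" for x y :: real
    proof -
      have "0 \<le> (x - \<alpha> * y)\<^sup>2 / (2 * \<alpha>)" using assms by simp
      also have "\<dots> = x\<^sup>2 / (2 * \<alpha>) + \<alpha> / 2 * y\<^sup>2 - x * y"
        using assms by (simp add: power2_eq_square field_simps)
      finally show ?thesis by simp
    qed
    from this[of "\<bar>a - b\<bar>" "a + b"] show ?thesis by simp
  qed
  also have "\<dots> \<le> (a - b)\<^sup>2 / (2 * \<alpha>) + \<alpha> * (p + q)"
  proof -
    have "(a + b)\<^sup>2 \<le> 2 * (p + q)"
      using ab sum_squares_bound[of a b] by (simp add: power2_eq_square algebra_simps)
    then have "\<alpha> / 2 * (a + b)\<^sup>2 \<le> \<alpha> / 2 * (2 * (p + q))"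
      using assms by (intro mult_left_mono) auto
    then show ?thesis by (simp add: algebra_simps)
  qed
  also have "\<dots> \<le> (p * ln p - p * ln q - p + q) / (2 * \<alpha>) + \<alpha> * (p + q)"
    using KL assms by (simp add: divide_right_mono)
  finally show ?thesis .
qed

text \<open>Gibbs' inequality against the uniform distribution: \<open>ln x \<le> x - 1\<close> is
  applied at \<open>x = 1 / (N * p y)\<close>, and the error terms \<open>1 / N - p y\<close> sum to
  zero.\<close>

lemma entropy_le_ln_card:
  fixes p :: "'a \<Rightarrow> real"
  assumes "finite A" "A \<noteq> {}" "\<And>y. y \<in> A \<Longrightarrow> 0 \<le> p y" "sum p A = 1"
  shows "- (\<Sum>y\<in>A. p y * ln (p y)) \<le> ln (card A)"
proof -
  let ?N = "real (card A)"
  have N: "0 < ?N" using assms by (simp add: card_gt_0_iff)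
  have "- (p y * ln (p y)) \<le> 1 / ?N - p y + p y * ln ?N" if "y \<in> A" for y
  proof (cases "p y = 0")
    case False
    then have pos: "0 < p y" using assms(3)[OF that] by simp
    have "ln (1 / (?N * p y)) \<le> 1 / (?N * p y) - 1"
      using pos N by (intro ln_le_minus_one) auto
    then have "- ln ?N - ln (p y) \<le> 1 / (?N * p y) - 1"
      using pos N by (simp add: ln_div ln_mult)
    then have "p y * (- ln ?N - ln (p y)) \<le> p y * (1 / (?N * p y) - 1)"
      using pos by (intro mult_left_mono) auto
    also have "\<dots> = 1 / ?N - p y" using pos N by (simp add: field_simps)
    finally show ?thesis by (simp add: algebra_simps)
  qed (use N in simp)
  then have "(\<Sum>y\<in>A. - (p y * ln (p y))) \<le> (\<Sum>y\<in>A. 1 / ?N - p y + p y * ln ?N)"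
    by (rule sum_mono)
  also have "\<dots> = ln ?N"
    using assms N by (simp add: sum.distrib sum_subtractf flip: sum_distrib_right)
  finally show ?thesis by (simp add: sum_negf)
qed

text \<open>The entropy increase in step \<open>l\<close> is the average relative entropy of the \<open>l\<close>-step distribution
  of a neighbour with respect to the mixture over all neighbours.\<close>

lemma doubly_stochastic_walk_smooth:
  fixes K :: "'a \<Rightarrow> 'a \<Rightarrow> real" and p :: "nat \<Rightarrow> 'a \<Rightarrow> 'a \<Rightarrow> real"
    and \<alpha> :: real and L :: nat
  assumes fin: "finite A" "A \<noteq> {}"
    and K_nonneg: "\<And>x z. 0 \<le> K x z"
    and row: "\<And>x. x \<in> A \<Longrightarrow> (\<Sum>z\<in>A. K x z) = 1"
    and col: "\<And>z. z \<in> A \<Longrightarrow> (\<Sum>x\<in>A. K x z) = 1"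
    and p_nonneg: "\<And>l x y. 0 \<le> p l x y"
    and p_sum: "\<And>l x. x \<in> A \<Longrightarrow> (\<Sum>y\<in>A. p l x y) = 1"
    and p_Suc: "\<And>l x y. x \<in> A \<Longrightarrow> p (Suc l) x y = (\<Sum>z\<in>A. K x z * p l z y)"
    and \<alpha>: "0 < \<alpha>" and L: "0 < L"
  obtains l where "l < L"
    "(\<Sum>x\<in>A. \<Sum>z\<in>A. K x z * (\<Sum>y\<in>A. \<bar>p l z y - p (Suc l) x y\<bar>))
       \<le> card A * (ln (card A) / (2 * \<alpha> * L) + 2 * \<alpha>)"
proof -
  define h where "h q = - (\<Sum>y\<in>A. q y * ln (q y))" for q :: "'a \<Rightarrow> real"
  define H where "H l = (\<Sum>x\<in>A. h (p l x))" for l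
  have p_le1: "p l x y \<le> 1" if "x \<in> A" "y \<in> A" for l x y
    using member_le_sum[of y A "p l x"] p_nonneg p_sum fin that by simp
  have h_nonneg: "0 \<le> h (p l x)" if "x \<in> A" for l x
    unfolding h_def sum_negf[symmetric]
  proof (rule sum_nonneg)
    fix y assume "y \<in> A"
    then show "0 \<le> - (p l x y * ln (p l x y))"
      using p_le1[OF that, of y l] p_nonneg[of l x y]
      by (cases "p l x y = 0") (auto simp: mult_nonneg_nonpos)
  qed
  have h_le: "h (p l x) \<le> ln (card A)" if "x \<in> A" for l x
    unfolding h_def using fin p_nonneg p_sum[OF that] by (intro entropy_le_ln_card) auto
  \<comment> \<open>The increments telescope to at most \<open>card A * ln (card A)\<close>, so one
    of the first \<open>L\<close> is at most the average.\<close>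
  have "\<exists>l<L. H (Suc l) - H l \<le> card A * ln (card A) / L"
  proof (rule ccontr)
    assume "\<not> ?thesis"
    then have "(\<Sum>l<L. card A * ln (card A) / L) < (\<Sum>l<L. H (Suc l) - H l)"
      using L by (intro sum_strict_mono) auto
    also have "\<dots> = H L - H 0" by (rule sum_lessThan_telescope)
    also have "\<dots> \<le> H L" using h_nonneg by (simp add: H_def sum_nonneg)
    also have "\<dots> \<le> card A * ln (card A)"
      unfolding H_def using h_le by (intro sum_bounded_above) auto
    finally show False using L by simp
  qed
  then obtain l where l: "l < L" "H (Suc l) - H l \<le> card A * ln (card A) / L" by auto
  define kl where "kl x z = (\<Sum>y\<in>A. p l z y * ln (p l z y) - p l z y * ln (p (Suc l) x y))" for x z
  \<comment> \<open>Absolute continuity: the mixture is positive wherever a component of positive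
    weight is, so the relative entropy is meaningful although \<open>ln 0 = 0\<close>.\<close>
  have mix: "0 < p (Suc l) x y"
    if "x \<in> A" "z \<in> A" "0 < K x z" "0 < p l z y" for x y z
  proof -
    have "K x z * p l z y \<le> p (Suc l) x y"
      unfolding p_Suc[OF that(1)] using fin that K_nonneg p_nonneg
      by (intro member_le_sum[where f = "\<lambda>z. K x z * p l z y"]) auto
    moreover have "0 < K x z * p l z y" using that by simp
    ultimately show ?thesis by linarith
  qed
  have pair: "K x z * (\<Sum>y\<in>A. \<bar>p l z y - p (Suc l) x y\<bar>) \<le> K x z * (kl x z / (2 * \<alpha>) + 2 * \<alpha>)"
    if xz: "x \<in> A" "z \<in> A" for x z
  proof (cases "K x z = 0")
    case False
    then have K: "0 < K x z" using K_nonneg[of x z] by simp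
    have "(\<Sum>y\<in>A. \<bar>p l z y - p (Suc l) x y\<bar>)
      \<le> (\<Sum>y\<in>A. (p l z y * ln (p l z y) - p l z y * ln (p (Suc l) x y) - p l z y + p (Suc l) x y) / (2 * \<alpha>)
             + \<alpha> * (p l z y + p (Suc l) x y))"
      by (intro sum_mono abs_diff_le_relative_entropy p_nonneg \<alpha> mix[OF xz K])
    also have "\<dots> = kl x z / (2 * \<alpha>) + 2 * \<alpha>"
      unfolding kl_def using p_sum xz
      by (simp add: sum.distrib sum_subtractf flip: sum_divide_distrib sum_distrib_left)
    finally show ?thesis using K by simp
  qed simp
  have "(\<Sum>x\<in>A. \<Sum>z\<in>A. K x z * kl x z) = H (Suc l) - H l"
  proof -
    have "(\<Sum>x\<in>A. \<Sum>z\<in>A. K x z * kl x z)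
        = (\<Sum>x\<in>A. \<Sum>z\<in>A. K x z * (\<Sum>y\<in>A. p l z y * ln (p l z y)))
          - (\<Sum>x\<in>A. \<Sum>z\<in>A. \<Sum>y\<in>A. K x z * p l z y * ln (p (Suc l) x y))"
      unfolding kl_def by (simp add: sum_subtractf right_diff_distrib sum_distrib_left mult.assoc)
    \<comment> \<open>Stationarity of the uniform distribution enters here: the column sums absorb
      the sum over \<open>x\<close>.\<close>
    also have "(\<Sum>x\<in>A. \<Sum>z\<in>A. K x z * (\<Sum>y\<in>A. p l z y * ln (p l z y))) = - H l"
      by (subst sum.swap) (simp add: col H_def h_def sum_negf flip: sum_distrib_right)
    also have "(\<Sum>x\<in>A. \<Sum>z\<in>A. \<Sum>y\<in>A. K x z * p l z y * ln (p (Suc l) x y)) = - H (Suc l)"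
    proof -
      have "(\<Sum>z\<in>A. \<Sum>y\<in>A. K x z * p l z y * ln (p (Suc l) x y)) = - h (p (Suc l) x)"
        if "x \<in> A" for x
        by (subst sum.swap) (simp add: p_Suc[OF that] h_def flip: sum_distrib_right)
      then show ?thesis by (simp add: H_def sum_negf)
    qed
    finally show ?thesis by simp
  qed
  then have "(\<Sum>x\<in>A. \<Sum>z\<in>A. K x z * (kl x z / (2 * \<alpha>) + 2 * \<alpha>))
      = (H (Suc l) - H l) / (2 * \<alpha>) + card A * (2 * \<alpha>)"
    using row by (simp add: distrib_left sum.distrib flip: sum_divide_distrib sum_distrib_right)
  also have "\<dots> \<le> (card A * ln (card A) / L) / (2 * \<alpha>) + card A * (2 * \<alpha>)"
    using l \<alpha> by (intro add_right_mono divide_right_mono) auto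
  also have "\<dots> = card A * (ln (card A) / (2 * \<alpha> * L) + 2 * \<alpha>)"
    by (simp add: field_simps)
  finally show ?thesis
    by (intro that[OF l(1)] order_trans[OF sum_mono[OF sum_mono[OF pair]]])
qed

subsection \<open>Rounding signed vectors\<close>

definition active_sign :: "real \<Rightarrow> real \<Rightarrow> real" where
  "active_sign t a = (if \<bar>a\<bar> > t then sgn a else 0)"

lemma measurable_active_sign [measurable]: "(\<lambda>t. active_sign t a) \<in> borel_measurable borel"
  unfolding active_sign_def by measurable

lemma active_sign_mult:
  assumes "c = 1 \<or> c = -1"
  shows "active_sign t (c * a) = c * active_sign t a"
  using assms by (auto simp: active_sign_def)

text \<open>Uniform on the unit interval, so that a coordinate \<open>a\<close> with
  \<open>\<bar>a\<bar> \<le> 1\<close> becomes active with probability exactly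
  \<open>\<bar>a\<bar>\<close>.\<close>

definition threshold :: "real measure" where
  "threshold = uniform_measure lborel {0<..<1}"

lemma prob_space_threshold: "prob_space threshold"
  unfolding threshold_def by (rule prob_space_uniform_measure) auto

lemma sets_threshold [simp, measurable_cong]: "sets threshold = sets borel"
  by (simp add: threshold_def)

lemma space_threshold [simp]: "space threshold = UNIV"
  by (simp add: threshold_def)

lemma prob_active:
  assumes "\<bar>a\<bar> \<le> 1"
  shows "measure threshold {t. active_sign t a \<noteq> 0} = \<bar>a\<bar>"
proof -
  have "{t. active_sign t a \<noteq> 0} \<in> sets lborel" by measurable
  moreover have "{0<..<1} \<inter> {t. active_sign t a \<noteq> 0} = {0<..<\<bar>a\<bar>}"
    using assms by (auto simp: active_sign_def sgn_eq_0_iff)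
  ultimately show ?thesis by (simp add: threshold_def measure_uniform_measure)
qed

text \<open>For equal signs only thresholds between \<open>\<bar>a\<bar>\<close> and
  \<open>\<bar>b\<bar>\<close> separate the two values; for different signs only thresholds up to
  \<open>max \<bar>a\<bar> \<bar>b\<bar>\<close> do, and this maximum is then at most
  \<open>\<bar>a - b\<bar>\<close>.\<close>

lemma prob_active_sign_neq_le:
  "measure threshold {t. active_sign t a \<noteq> active_sign t b} \<le> \<bar>a - b\<bar>"
proof -
  let ?S = "{t. active_sign t a \<noteq> active_sign t b}"
  let ?I = "if sgn a = sgn b then {min \<bar>a\<bar> \<bar>b\<bar>..max \<bar>a\<bar> \<bar>b\<bar>} else {0..max \<bar>a\<bar> \<bar>b\<bar>}"
  have S: "?S \<in> sets lborel" by measurable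
  have "measure lborel ({0<..<1} \<inter> ?S) \<le> measure lborel ?I"
    by (rule measure_mono_fmeasurable)
       (use S in \<open>auto simp: active_sign_def fmeasurable_def split: if_splits\<close>)
  also have "\<dots> \<le> \<bar>a - b\<bar>" by (auto simp: sgn_real_def split: if_splits)
  finally show ?thesis using S by (simp add: threshold_def measure_uniform_measure)
qed

text \<open>\<open>s\<close> and \<open>t\<close> are found by averaging over all of them; the strictly positive slack \<open>\<kappa>\<close> makes
  the average of the relevant difference negative and thereby forces a nonempty active set.\<close>

lemma exists_rounding_threshold:
  fixes Q :: "'v \<Rightarrow> 's \<Rightarrow> real" and w :: "'j \<Rightarrow> real" and r \<tau> :: "'j \<Rightarrow> _ \<Rightarrow> real" and c \<kappa> :: real
  assumes fin: "finite U" "U \<noteq> {}" "finite J" "finite X"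
    and vars: "\<And>j. j \<in> J \<Longrightarrow> vars j \<noteq> {} \<and> vars j \<subseteq> U"
    and Q_le: "\<And>u s. u \<in> U \<Longrightarrow> s \<in> X \<Longrightarrow> \<bar>Q u s\<bar> \<le> 1"
    and Q_mass: "\<And>u. u \<in> U \<Longrightarrow> c \<le> (\<Sum>s\<in>X. \<bar>Q u s\<bar>)"
    and w: "\<And>j. j \<in> J \<Longrightarrow> (\<Sum>s\<in>X. \<Sum>v\<in>vars j. \<bar>\<tau> j v * Q v s - r j s\<bar>) \<le> c * w j"
    and c: "0 < c" and \<kappa>: "0 < \<kappa>" and w_nonneg: "\<And>j. j \<in> J \<Longrightarrow> 0 \<le> w j"
  obtains s t where "s \<in> X"
    "{u \<in> U. active_sign t (Q u s) \<noteq> 0} \<noteq> {}"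
    "card {j \<in> J. \<not> (\<exists>e. \<forall>v\<in>vars j. active_sign t (\<tau> j v * Q v s) = e)}
       \<le> (\<Sum>j | j \<in> J \<and> (\<exists>v\<in>vars j. active_sign t (Q v s) \<noteq> 0). w j)
           + \<kappa> * card {u \<in> U. active_sign t (Q u s) \<noteq> 0}"
proof -
  interpret prob_space threshold by (rule prob_space_threshold)
  have Q_le': "\<bar>Q v s\<bar> \<le> 1" if "j \<in> J" "v \<in> vars j" "s \<in> X" for j v s
    using that vars Q_le by blast
  define bad where "bad j s t \<longleftrightarrow> \<not> (\<exists>e. \<forall>v\<in>vars j. active_sign t (\<tau> j v * Q v s) = e)" for j s t
  \<comment> \<open>A single representative replaces the event that some variable of
    \<open>j\<close> is active. Its activation probabilities sum over \<open>s\<close> to at least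
    \<open>c\<close>, which pays for the weight \<open>w j\<close>.\<close>
  define pick where "pick j = (SOME v. v \<in> vars j)" for j
  have pick: "pick j \<in> vars j" if "j \<in> J" for j
    using vars[OF that] by (simp add: pick_def some_in_eq)
  let ?on = "\<lambda>u s. {t. active_sign t (Q u s) \<noteq> 0}"
  let ?neq = "\<lambda>j v s. {t. active_sign t (\<tau> j v * Q v s) \<noteq> active_sign t (r j s)}"
  define D where "D s t = (\<Sum>j\<in>J. \<Sum>v\<in>vars j. indicat_real (?neq j v s) t)
     - (\<Sum>j\<in>J. w j * indicat_real (?on (pick j) s) t) - \<kappa> * (\<Sum>u\<in>U. indicat_real (?on u s) t)" for s t
  have fin_vars: "finite (vars j)" if "j \<in> J" for j
    using vars[OF that] fin finite_subset by blast
  have [measurable]: "?on u s \<in> events" "?neq j v s \<in> events" for u j v s by measurable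
  have on: "prob (?on u s) = \<bar>Q u s\<bar>" if "u \<in> U" "s \<in> X" for u s
    using Q_le[OF that] by (rule prob_active)
  have on_pick: "prob (?on (pick j) s) = \<bar>Q (pick j) s\<bar>" if "j \<in> J" "s \<in> X" for j s
    using Q_le'[OF that(1) pick[OF that(1)] that(2)] by (rule prob_active)
  have int: "integrable threshold (indicat_real A)" if "A \<in> events" for A
    using that by (simp add: integrable_real_indicator emeasure_eq_measure)
  have "(\<Sum>s\<in>X. expectation (D s)) =
      (\<Sum>s\<in>X. (\<Sum>j\<in>J. \<Sum>v\<in>vars j. prob (?neq j v s))
        - (\<Sum>j\<in>J. w j * prob (?on (pick j) s)) - \<kappa> * (\<Sum>u\<in>U. prob (?on u s)))"
    unfolding D_def using int by (intro sum.cong) (simp_all add: Bochner_Integration.integral_diff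
       Bochner_Integration.integral_sum)
  also have "\<dots> \<le> (\<Sum>s\<in>X. (\<Sum>j\<in>J. \<Sum>v\<in>vars j. \<bar>\<tau> j v * Q v s - r j s\<bar>)
        - (\<Sum>j\<in>J. w j * \<bar>Q (pick j) s\<bar>) - \<kappa> * (\<Sum>u\<in>U. \<bar>Q u s\<bar>))"
    by (intro sum_mono diff_mono prob_active_sign_neq_le) (simp_all add: on on_pick)
  also have "\<dots> = (\<Sum>j\<in>J. (\<Sum>s\<in>X. \<Sum>v\<in>vars j. \<bar>\<tau> j v * Q v s - r j s\<bar>) - w j * (\<Sum>s\<in>X. \<bar>Q (pick j) s\<bar>))
      - \<kappa> * (\<Sum>u\<in>U. \<Sum>s\<in>X. \<bar>Q u s\<bar>)"
    by (simp add: sum_subtractf sum_distrib_left sum.swap[of _ X])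
  also have "\<dots> \<le> 0 - \<kappa> * (\<Sum>u\<in>U. c)"
  proof (intro diff_mono sum_nonpos mult_left_mono sum_mono Q_mass)
    fix j assume j: "j \<in> J"
    have "w j * c \<le> w j * (\<Sum>s\<in>X. \<bar>Q (pick j) s\<bar>)"
      using j pick vars w_nonneg Q_mass by (intro mult_left_mono) blast+
    then show "(\<Sum>s\<in>X. \<Sum>v\<in>vars j. \<bar>\<tau> j v * Q v s - r j s\<bar>) - w j * (\<Sum>s\<in>X. \<bar>Q (pick j) s\<bar>) \<le> 0"
      using w[OF j] by (simp add: mult.commute)
  qed (use \<kappa> in auto)
  also have "\<dots> < 0" using fin c \<kappa> by (simp add: card_gt_0_iff)
  finally obtain s where s: "s \<in> X" "expectation (D s) < 0"
    by (metis not_le sum_nonneg)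
  then obtain t where t: "D s t < 0"
    by (metis Bochner_Integration.integral_nonneg not_le)
  let ?S = "{u \<in> U. active_sign t (Q u s) \<noteq> 0}"
  have S: "(\<Sum>u\<in>U. indicat_real (?on u s) t) = card ?S"
    using fin by (simp add: indicator_def sum.If_cases Int_def)
  \<comment> \<open>If no variable of \<open>j\<close> disagreed with the rounding of
    \<open>r j s\<close>, that value would be a common \<open>e\<close>; hence every bad
    \<open>j\<close> contributes at least 1 to the double sum.\<close>
  have neq: "real (card {j \<in> J. bad j s t}) \<le> (\<Sum>j\<in>J. \<Sum>v\<in>vars j. indicat_real (?neq j v s) t)"
  proof -
    have "of_bool (bad j s t) \<le> (\<Sum>v\<in>vars j. indicat_real (?neq j v s) t)" if j: "j \<in> J" for j
    proof (cases "bad j s t")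
      case True
      then obtain v where v: "v \<in> vars j" "t \<in> ?neq j v s" unfolding bad_def by blast
      then have "1 = indicat_real (?neq j v s) t" by simp
      also have "\<dots> \<le> (\<Sum>v\<in>vars j. indicat_real (?neq j v s) t)"
        using v fin_vars[OF j] by (intro member_le_sum[where f = "\<lambda>v. indicat_real (?neq j v s) t"]) auto
      finally show ?thesis using True by simp
    qed (simp add: sum_nonneg)
    then have "(\<Sum>j\<in>J. of_bool (bad j s t)) \<le> (\<Sum>j\<in>J. \<Sum>v\<in>vars j. indicat_real (?neq j v s) t)"
      by (rule sum_mono)
    then show ?thesis using fin by (simp add: of_bool_def sum.If_cases Int_def)
  qed
  have touch: "(\<Sum>j\<in>J. w j * indicat_real (?on (pick j) s) t)
      \<le> (\<Sum>j | j \<in> J \<and> (\<exists>v\<in>vars j. active_sign t (Q v s) \<noteq> 0). w j)"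
  proof -
    have "(\<Sum>j\<in>J. w j * indicat_real (?on (pick j) s) t)
        \<le> (\<Sum>j\<in>J. if \<exists>v\<in>vars j. active_sign t (Q v s) \<noteq> 0 then w j else 0)"
      using pick w_nonneg by (intro sum_mono) (auto simp: indicator_def)
    also have "\<dots> = (\<Sum>j | j \<in> J \<and> (\<exists>v\<in>vars j. active_sign t (Q v s) \<noteq> 0). w j)"
      using fin by (simp add: sum.If_cases Int_def)
    finally show ?thesis .
  qed
  have "?S \<noteq> {}"
  proof
    assume e: "?S = {}"
    then have "(\<Sum>j\<in>J. w j * indicat_real (?on (pick j) s) t) = 0"
      using pick vars by (intro sum.neutral) (auto simp: indicator_def)
    moreover have "0 \<le> (\<Sum>j\<in>J. \<Sum>v\<in>vars j. indicat_real (?neq j v s) t)"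
      using neq of_nat_0_le_iff order_trans by blast
    ultimately show False using t S unfolding D_def e by simp
  qed
  moreover have "real (card {j \<in> J. bad j s t})
      \<le> (\<Sum>j | j \<in> J \<and> (\<exists>v\<in>vars j. active_sign t (Q v s) \<noteq> 0). w j) + \<kappa> * card ?S"
    using t neq touch unfolding D_def S by linarith
  ultimately show ?thesis using s that unfolding bad_def by blast
qed

text \<open>Induction on the number of unassigned variables. One round fixes the active set
  \<open>S\<close> and discards the touched constraints \<open>T\<close>; the other constraints lie
  entirely in \<open>U - S\<close>. Each \<open>w j\<close> is charged only in the round that first
  touches \<open>j\<close>, and the slack \<open>\<kappa>\<close> once per assigned
  variable.\<close>

lemma signed_rounding:
  fixes Q :: "'v \<Rightarrow> 's \<Rightarrow> real" and w :: "'j \<Rightarrow> real" and r \<tau> :: "'j \<Rightarrow> _ \<Rightarrow> real" and c \<kappa> :: real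
  assumes "finite U" "finite J" "finite X"
    and "\<And>j. j \<in> J \<Longrightarrow> vars j \<noteq> {} \<and> vars j \<subseteq> U"
    and "\<And>u s. u \<in> U \<Longrightarrow> s \<in> X \<Longrightarrow> \<bar>Q u s\<bar> \<le> 1"
    and "\<And>u. u \<in> U \<Longrightarrow> c \<le> (\<Sum>s\<in>X. \<bar>Q u s\<bar>)"
    and "\<And>j. j \<in> J \<Longrightarrow> (\<Sum>s\<in>X. \<Sum>v\<in>vars j. \<bar>\<tau> j v * Q v s - r j s\<bar>) \<le> c * w j"
    and \<tau>: "\<And>j v. \<tau> j v = 1 \<or> \<tau> j v = -1"
    and "0 < c" "0 < \<kappa>" "\<And>j. j \<in> J \<Longrightarrow> 0 \<le> w j"
  shows "\<exists>x :: 'v \<Rightarrow> real. (\<forall>u\<in>U. x u = 1 \<or> x u = -1) \<and>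
    card {j \<in> J. \<not> (\<exists>e. \<forall>v\<in>vars j. \<tau> j v * x v = e)} \<le> (\<Sum>j\<in>J. w j) + \<kappa> * card U"
  using assms(1,2,4-7,11)
proof (induction "card U" arbitrary: U J rule: less_induct)
  case less
  note prems = less.prems
  show ?case
  proof (cases "U = {}")
    case True
    then have "J = {}" using prems(3) by blast
    then show ?thesis using True by auto
  next
    case False
    obtain s t where st: "s \<in> X" "{u \<in> U. active_sign t (Q u s) \<noteq> 0} \<noteq> {}"
      "card {j \<in> J. \<not> (\<exists>e. \<forall>v\<in>vars j. active_sign t (\<tau> j v * Q v s) = e)}
       \<le> (\<Sum>j | j \<in> J \<and> (\<exists>v\<in>vars j. active_sign t (Q v s) \<noteq> 0). w j)
           + \<kappa> * card {u \<in> U. active_sign t (Q u s) \<noteq> 0}"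
      by (rule exists_rounding_threshold[OF prems(1) False prems(2) assms(3) prems(3-6) assms(9,10) prems(7)])
         blast+
    let ?g = "\<lambda>v. active_sign t (Q v s)"
    define S where "S = {u \<in> U. ?g u \<noteq> 0}"
    define T where "T = {j \<in> J. \<exists>v\<in>vars j. ?g v \<noteq> 0}"
    have S: "S \<subseteq> U" "S \<noteq> {}" using st by (auto simp: S_def)
    have less': "card (U - S) < card U" using S prems(1) by (intro psubset_card_mono) auto
    have "\<exists>x :: 'v \<Rightarrow> real. (\<forall>u\<in>U - S. x u = 1 \<or> x u = -1) \<and>
      card {j \<in> J - T. \<not> (\<exists>e. \<forall>v\<in>vars j. \<tau> j v * x v = e)} \<le> (\<Sum>j\<in>J - T. w j) + \<kappa> * card (U - S)"
    proof (rule less.hyps[OF less'])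
      show "vars j \<noteq> {} \<and> vars j \<subseteq> U - S" if "j \<in> J - T" for j
        using that prems(3)[of j] by (auto simp: S_def T_def)
    qed (use prems in auto)
    then obtain x where x: "\<forall>u\<in>U - S. x u = 1 \<or> x u = -1"
      "card {j \<in> J - T. \<not> (\<exists>e. \<forall>v\<in>vars j. \<tau> j v * x v = e)} \<le> (\<Sum>j\<in>J - T. w j) + \<kappa> * card (U - S)"
      by blast
    define y where "y u = (if u \<in> S then ?g u else x u)" for u
    have y: "\<forall>u\<in>U. y u = 1 \<or> y u = -1"
      using x(1) by (auto simp: y_def S_def active_sign_def sgn_real_def)
    \<comment> \<open>A touched constraint whose rounding is consistent has a nonzero common value,
      so all its variables are in \<open>S\<close> and it holds under \<open>y\<close>. An untouched
      one avoids \<open>S\<close> and sees only \<open>x\<close>.\<close>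
    have "{j \<in> J. \<not> (\<exists>e. \<forall>v\<in>vars j. \<tau> j v * y v = e)}
      \<subseteq> {j \<in> J - T. \<not> (\<exists>e. \<forall>v\<in>vars j. \<tau> j v * x v = e)}
        \<union> {j \<in> J. \<not> (\<exists>e. \<forall>v\<in>vars j. active_sign t (\<tau> j v * Q v s) = e)}"
    proof (rule subsetI, rule ccontr)
      fix j assume j: "j \<in> {j \<in> J. \<not> (\<exists>e. \<forall>v\<in>vars j. \<tau> j v * y v = e)}"
        and n: "j \<notin> {j \<in> J - T. \<not> (\<exists>e. \<forall>v\<in>vars j. \<tau> j v * x v = e)}
        \<union> {j \<in> J. \<not> (\<exists>e. \<forall>v\<in>vars j. active_sign t (\<tau> j v * Q v s) = e)}"
      obtain e where e: "\<forall>v\<in>vars j. \<tau> j v * ?g v = e"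
        using n j by (auto simp: active_sign_mult[OF \<tau>])
      have sub: "vars j \<subseteq> U" using j prems(3) by blast
      show False
      proof (cases "j \<in> T")
        case True
        then obtain v where "v \<in> vars j" "?g v \<noteq> 0" by (auto simp: T_def)
        then have "e \<noteq> 0" using e \<tau>[of j v] by auto
        then have "\<forall>v\<in>vars j. v \<in> S" using e sub by (auto simp: S_def)
        then show False using e j by (auto simp: y_def)
      next
        case False
        then have "\<forall>v\<in>vars j. v \<notin> S" using j by (auto simp: T_def S_def)
        then show False using n j False by (auto simp: y_def)
      qed
    qed
    then have "card {j \<in> J. \<not> (\<exists>e. \<forall>v\<in>vars j. \<tau> j v * y v = e)}
       \<le> card ({j \<in> J - T. \<not> (\<exists>e. \<forall>v\<in>vars j. \<tau> j v * x v = e)}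
        \<union> {j \<in> J. \<not> (\<exists>e. \<forall>v\<in>vars j. active_sign t (\<tau> j v * Q v s) = e)})"
      using prems(2) by (intro card_mono) auto
    also have "\<dots> \<le> card {j \<in> J - T. \<not> (\<exists>e. \<forall>v\<in>vars j. \<tau> j v * x v = e)}
        + card {j \<in> J. \<not> (\<exists>e. \<forall>v\<in>vars j. active_sign t (\<tau> j v * Q v s) = e)}"
      by (rule card_Un_le)
    finally have "real (card {j \<in> J. \<not> (\<exists>e. \<forall>v\<in>vars j. \<tau> j v * y v = e)})
       \<le> ((\<Sum>j\<in>J - T. w j) + \<kappa> * card (U - S)) + ((\<Sum>j\<in>T. w j) + \<kappa> * card S)"
      using x(2) st(3) unfolding S_def[symmetric] T_def[symmetric] by linarith
    also have "\<dots> = (\<Sum>j\<in>J. w j) + \<kappa> * card U"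
    proof -
      have "(\<Sum>j\<in>J - T. w j) + (\<Sum>j\<in>T. w j) = (\<Sum>j\<in>J. w j)"
        using prems(2) by (subst sum.subset_diff[of T J w]) (auto simp: T_def)
      moreover have "card U = card (U - S) + card S"
        using S prems(1) by (simp add: card_Diff_subset finite_subset card_mono)
      ultimately show ?thesis by (simp add: algebra_simps)
    qed
    finally show ?thesis using y by blast
  qed
qed

subsection \<open>The tester\<close>

text \<open>Continuation-passing style provides sequencing for \<open>query_alg\<close>:
  \<open>cs\<close> collects the constraints seen and \<open>\<kappa>\<close> receives them. An
  unanswered index leaves the walk in place, which makes the transition matrix symmetric at
  irregular degrees.\<close>

primrec walk :: "nat \<Rightarrow> nat \<Rightarrow> nat \<Rightarrow> equ_constraint list \<Rightarrow> (equ_constraint list \<Rightarrow> query_alg) \<Rightarrow> query_alg"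
  where
  "walk d 0 u cs \<kappa> = \<kappa> cs"
| "walk d (Suc l) u cs \<kappa> = Sample (pmf_of_set {1..d}) (\<lambda>i. Query u i (\<lambda>ans.
     case ans of None \<Rightarrow> walk d l u cs \<kappa>
     | Some c \<Rightarrow> Sample (pmf_of_set (constraint_vars c)) (\<lambda>v. walk d l v (c # cs) \<kappa>)))"

primrec walks :: "nat \<Rightarrow> nat \<Rightarrow> nat \<Rightarrow> nat \<Rightarrow> equ_constraint list \<Rightarrow> (equ_constraint list \<Rightarrow> query_alg) \<Rightarrow> query_alg"
  where
  "walks d l s 0 cs \<kappa> = \<kappa> cs"
| "walks d l s (Suc m) cs \<kappa> = walk d l s cs (\<lambda>cs'. walks d l s m cs' \<kappa>)"

text \<open>Reads all constraints at \<open>u\<close>. This catches constraints that are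
  unsatisfiable on their own because a variable occurs with both signs, for which parities along
  walks are not meaningful.\<close>

primrec scan :: "nat \<Rightarrow> nat \<Rightarrow> equ_constraint list \<Rightarrow> (equ_constraint list \<Rightarrow> query_alg) \<Rightarrow> query_alg" where
  "scan u 0 cs \<kappa> = \<kappa> cs"
| "scan u (Suc i) cs \<kappa> = Query u (Suc i) (\<lambda>ans.
     scan u i (case ans of None \<Rightarrow> cs | Some c \<Rightarrow> c # cs) \<kappa>)"

text \<open>A suitable walk length is only known to exist below \<open>L\<close>, so it is guessed.
  Of the \<open>2 * m\<close> walks the analysis uses \<open>m\<close> to collect end points and
  \<open>m\<close> to hit them with the opposite parity.\<close>

definition test_round :: "nat \<Rightarrow> nat \<Rightarrow> nat \<Rightarrow> nat \<Rightarrow> (equ_constraint list \<Rightarrow> query_alg) \<Rightarrow> query_alg" where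
  "test_round n d L m \<kappa> = Sample (pmf_of_set {..<n}) (\<lambda>s. Sample (pmf_of_set {..<L}) (\<lambda>l.
     scan s d [] (\<lambda>cs. walks d l s (2 * m) cs \<kappa>)))"

definition satisfies :: "nat \<Rightarrow> (nat \<Rightarrow> bit) \<Rightarrow> equ_constraint list \<Rightarrow> bool" where
  "satisfies k \<sigma> cs \<longleftrightarrow> (\<forall>c\<in>set cs. sat_constraint k \<sigma> c)"

primrec tester :: "nat \<Rightarrow> nat \<Rightarrow> nat \<Rightarrow> nat \<Rightarrow> nat \<Rightarrow> nat \<Rightarrow> query_alg" where
  "tester k n d L m 0 = Verdict True"
| "tester k n d L m (Suc R) = test_round n d L m (\<lambda>cs.
     if \<exists>\<sigma>. satisfies k \<sigma> cs then tester k n d L m R else Verdict False)"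

subsection \<open>Query complexity and completeness\<close>

text \<open>Query bound and one-sidedness share one predicate, so a single induction per procedure
  serves both; \<open>acc\<close> is later instantiated with satisfiability of the instance.\<close>

definition runs_within :: "(nat \<Rightarrow> nat \<Rightarrow> equ_constraint option) \<Rightarrow> bool \<Rightarrow> nat \<Rightarrow> query_alg \<Rightarrow> bool" where
  "runs_within orc acc N A \<longleftrightarrow> (\<forall>(b, q)\<in>set_pmf (run_alg orc A). q \<le> N \<and> (acc \<longrightarrow> b))"

lemma runs_within_Verdict: "(acc \<longrightarrow> b) \<Longrightarrow> runs_within orc acc N (Verdict b)"
  by (simp add: runs_within_def)

lemma runs_within_Sample:
  "(\<And>r. r \<in> set_pmf p \<Longrightarrow> runs_within orc acc N (f r)) \<Longrightarrow> runs_within orc acc N (Sample p f)"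
  by (fastforce simp: runs_within_def)

lemma runs_within_Query:
  "runs_within orc acc N (f (orc x i)) \<Longrightarrow> runs_within orc acc (Suc N) (Query x i f)"
  by (fastforce simp: runs_within_def)

lemma runs_within_mono: "runs_within orc acc N A \<Longrightarrow> N \<le> N' \<Longrightarrow> runs_within orc acc N' A"
  by (fastforce simp: runs_within_def)

context
  fixes orc :: "nat \<Rightarrow> nat \<Rightarrow> equ_constraint option" and C :: "equ_constraint set" and acc :: bool
  assumes orc_in: "\<And>x i c. orc x i = Some c \<Longrightarrow> c \<in> C"
begin

lemma runs_within_walk:
  assumes "\<And>cs'. set cs' \<subseteq> C \<Longrightarrow> runs_within orc acc N (\<kappa> cs')" "set cs \<subseteq> C"
  shows "runs_within orc acc (l + N) (walk d l u cs \<kappa>)"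
  using assms(2)
proof (induction l arbitrary: u cs)
  case 0
  then show ?case using assms(1) by simp
next
  case (Suc l)
  then show ?case using orc_in
    by (auto intro!: runs_within_Sample runs_within_Query split: option.split)
qed

lemma runs_within_walks:
  assumes "\<And>cs'. set cs' \<subseteq> C \<Longrightarrow> runs_within orc acc N (\<kappa> cs')" "set cs \<subseteq> C"
  shows "runs_within orc acc (m * l + N) (walks d l s m cs \<kappa>)"
  using assms(2)
proof (induction m arbitrary: cs)
  case 0
  then show ?case using assms(1) by simp
next
  case (Suc m)
  then show ?case
    using runs_within_walk[of "m * l + N" "\<lambda>cs'. walks d l s m cs' \<kappa>" cs l d s]
    by (simp add: add.assoc)
qed

lemma runs_within_scan:
  assumes "\<And>cs'. set cs' \<subseteq> C \<Longrightarrow> runs_within orc acc N (\<kappa> cs')" "set cs \<subseteq> C"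
  shows "runs_within orc acc (i + N) (scan u i cs \<kappa>)"
  using assms(2)
proof (induction i arbitrary: cs)
  case 0
  then show ?case using assms(1) by simp
next
  case (Suc i)
  then show ?case using orc_in
    by (auto intro!: runs_within_Query split: option.split)
qed

lemma runs_within_round:
  assumes "\<And>cs'. set cs' \<subseteq> C \<Longrightarrow> runs_within orc acc N (\<kappa> cs')" "0 < L"
  shows "runs_within orc acc (d + 2 * m * L + N) (test_round n d L m \<kappa>)"
  unfolding test_round_def
proof (intro runs_within_Sample)
  fix s l assume "l \<in> set_pmf (pmf_of_set {..<L})"
  then have "l < L" using assms(2) by (subst (asm) set_pmf_of_set) auto
  then have "2 * m * l + N \<le> 2 * m * L + N" by simp
  then have "runs_within orc acc (2 * m * L + N) (walks d l s (2 * m) cs \<kappa>)" if "set cs \<subseteq> C" for cs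
    using runs_within_walks[where N = N and \<kappa> = \<kappa>, OF assms(1) that] runs_within_mono by blast
  then show "runs_within orc acc (d + 2 * m * L + N) (scan s d [] (\<lambda>cs. walks d l s (2 * m) cs \<kappa>))"
    using runs_within_scan[of "2 * m * L + N"] by (simp add: add.assoc)
qed

lemma runs_within_tester:
  assumes "0 < L" "acc \<Longrightarrow> \<exists>\<sigma>. \<forall>c\<in>C. sat_constraint k \<sigma> c"
  shows "runs_within orc acc (R * (d + 2 * m * L)) (tester k n d L m R)"
proof (induction R)
  case 0
  then show ?case by (simp add: runs_within_Verdict)
next
  case (Suc R)
  show ?case unfolding tester.simps mult_Suc
  proof (rule runs_within_round[OF _ assms(1)])
    fix cs :: "equ_constraint list" assume "set cs \<subseteq> C"
    then have "acc \<longrightarrow> (\<exists>\<sigma>. satisfies k \<sigma> cs)" using assms(2) by (fastforce simp: satisfies_def)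
    then show "runs_within orc acc (R * (d + 2 * m * L))
        (if \<exists>\<sigma>. satisfies k \<sigma> cs then tester k n d L m R else Verdict False)"
      using Suc by (auto intro: runs_within_Verdict)
  qed
qed

end

subsection \<open>Acceptance probability\<close>

lemma bounded_pmf:
  fixes f :: "'b \<Rightarrow> real" and p :: "'b pmf"
  assumes "\<And>x. 0 \<le> f x" "\<And>x. f x \<le> B"
  shows integrable_bounded_pmf: "integrable p f"
    and integral_bounded_pmf_nonneg: "0 \<le> (\<integral>y. f y \<partial>p)"
    and integral_bounded_pmf_le: "(\<integral>y. f y \<partial>p) \<le> B"
proof -
  show int: "integrable p f"
    using assms by (intro measure_pmf.integrable_const_bound[where B = B]) auto
  show "0 \<le> (\<integral>y. f y \<partial>p)" using assms by (simp add: integral_nonneg_AE)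
  have "(\<integral>y. f y \<partial>p) \<le> (\<integral>y. B \<partial>p)"
    using assms by (intro integral_mono int) auto
  then show "(\<integral>y. f y \<partial>p) \<le> B" by simp
qed

lemma integral_bind_pmf:
  fixes f :: "'b \<Rightarrow> real"
  assumes "\<And>x. 0 \<le> f x" "\<And>x. f x \<le> B"
  shows "(\<integral>x. f x \<partial>bind_pmf M N) = (\<integral>x. (\<integral>y. f y \<partial>N x) \<partial>M)"
proof -
  note int = integrable_bounded_pmf[of f, OF assms]
  note nonneg = integral_bounded_pmf_nonneg[of f, OF assms]
  note le = integral_bounded_pmf_le[of f, OF assms]
  have int2: "integrable M (\<lambda>x. \<integral>y. f y \<partial>N x)"
    using le nonneg by (intro measure_pmf.integrable_const_bound[where B = B]) auto
  have "ennreal (\<integral>x. f x \<partial>bind_pmf M N) = (\<integral>\<^sup>+x. \<integral>\<^sup>+y. f y \<partial>N x \<partial>M)"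
    using assms by (simp add: nn_integral_eq_integral[OF int, symmetric])
  also have "\<dots> = ennreal (\<integral>x. (\<integral>y. f y \<partial>N x) \<partial>M)"
    using assms nonneg by (simp add: nn_integral_eq_integral int int2)
  finally show ?thesis using nonneg by (simp add: integral_nonneg_AE)
qed

definition accept :: "(nat \<Rightarrow> nat \<Rightarrow> equ_constraint option) \<Rightarrow> query_alg \<Rightarrow> real" where
  "accept orc A = measure_pmf.prob (run_alg orc A) {(b, q). b}"

lemma accept_nonneg: "0 \<le> accept orc A" by (simp add: accept_def)

lemma accept_le_1: "accept orc A \<le> 1" by (simp add: accept_def)

lemma accept_Verdict [simp]: "accept orc (Verdict b) = of_bool b"
  by (simp add: accept_def indicator_def)

lemma accept_Query [simp]: "accept orc (Query x i f) = accept orc (f (orc x i))"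
  by (simp add: accept_def vimage_def case_prod_unfold)

lemma accept_Sample: "accept orc (Sample p f) = (\<integral>r. accept orc (f r) \<partial>p)"
proof -
  have "accept orc (Sample p f)
      = (\<integral>x. indicat_real {(b, q). b} x \<partial>bind_pmf p (\<lambda>r. run_alg orc (f r)))"
    by (simp add: accept_def)
  also have "\<dots> = (\<integral>r. accept orc (f r) \<partial>p)"
    by (subst integral_bind_pmf[where B = 1]) (auto simp: accept_def)
  finally show ?thesis .
qed

lemma accept_Sample_le:
  fixes g :: "nat \<Rightarrow> real"
  assumes "\<And>r. r \<in> set_pmf p \<Longrightarrow> accept orc (f r) \<le> g r" "\<And>r. 0 \<le> g r" "\<And>r. g r \<le> B"
  shows "accept orc (Sample p f) \<le> (\<integral>r. g r \<partial>p)"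
  unfolding accept_Sample
  using assms accept_nonneg accept_le_1
  by (intro integral_mono_AE measure_pmf.integrable_const_bound[where B = 1]
      measure_pmf.integrable_const_bound[where B = B])
     (auto simp: AE_measure_pmf_iff)

subsection \<open>The walk on the double cover\<close>

text \<open>The offset is only meaningful if no variable of \<open>c\<close> occurs with both signs.\<close>

definition offset :: "equ_constraint \<Rightarrow> nat \<Rightarrow> bit" where
  "offset c v = the (map_of c v)"

lemma offset_in:
  assumes "v \<in> constraint_vars c" shows "(v, offset c v) \<in> set c"
proof -
  have "map_of c v \<noteq> None" using assms by (simp add: constraint_vars_def map_of_eq_None_iff)
  then show ?thesis by (auto simp: offset_def dest: map_of_SomeD)
qed

lemma sat_constraint_edge:
  assumes "sat_constraint k \<sigma> c" "u \<in> constraint_vars c" "v \<in> constraint_vars c"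
  shows "\<sigma> v = \<sigma> u + offset c u + offset c v"
proof -
  have "\<sigma> u + offset c u = \<sigma> v + offset c v"
    using assms(1) imageI[OF offset_in[OF assms(2)], of "\<lambda>(x, b). \<sigma> x + b"]
      imageI[OF offset_in[OF assms(3)], of "\<lambda>(x, b). \<sigma> x + b"]
    unfolding sat_constraint_def equ_def set_map case_prod_conv by blast
  then show ?thesis by (cases "\<sigma> u"; cases "\<sigma> v"; cases "offset c u"; cases "offset c v") auto
qed

text \<open>A state \<open>(v, a)\<close> reached from \<open>(u, 0)\<close> records that the constraints seen on the way force
  \<open>\<sigma> v = \<sigma> u + a\<close>.\<close>

definition cover_step :: "(nat \<Rightarrow> nat \<Rightarrow> equ_constraint option) \<Rightarrow> nat \<Rightarrow> nat \<times> bit \<Rightarrow> (nat \<times> bit) pmf" where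
  "cover_step orc d = (\<lambda>(u, a). bind_pmf (pmf_of_set {1..d}) (\<lambda>i. case orc u i of
      None \<Rightarrow> return_pmf (u, a)
    | Some c \<Rightarrow> map_pmf (\<lambda>v. (v, a + offset c u + offset c v)) (pmf_of_set (constraint_vars c))))"

primrec cover_walk :: "(nat \<Rightarrow> nat \<Rightarrow> equ_constraint option) \<Rightarrow> nat \<Rightarrow> nat \<Rightarrow> nat \<times> bit \<Rightarrow> (nat \<times> bit) pmf" where
  "cover_walk orc d 0 x = return_pmf x"
| "cover_walk orc d (Suc l) x = bind_pmf (cover_step orc d x) (cover_walk orc d l)"

text \<open>The parity is bookkeeping of the analysis only: the algorithm moves on variables, while
  the proof follows the same step on the cover. The invariant is that the constraints seen so far
  force the current variable to differ from the start \<open>s\<close> by the recorded bit.\<close>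

lemma accept_walk_le:
  fixes g :: "nat \<times> bit \<Rightarrow> real"
  assumes orc: "\<And>x i c. orc x i = Some c \<Longrightarrow> x \<in> constraint_vars c"
    and \<kappa>: "\<And>v b cs'. set cs \<subseteq> set cs' \<Longrightarrow> (\<And>\<sigma>. satisfies k \<sigma> cs' \<Longrightarrow> \<sigma> v = \<sigma> s + b)
      \<Longrightarrow> accept orc (\<kappa> cs') \<le> g (v, b)"
    and g: "\<And>x. 0 \<le> g x" "\<And>x. g x \<le> B"
    and inv: "\<And>\<sigma>. satisfies k \<sigma> cs \<Longrightarrow> \<sigma> u = \<sigma> s + a"
  shows "accept orc (walk d l u cs \<kappa>) \<le> (\<integral>x. g x \<partial>cover_walk orc d l (u, a))"
  using \<kappa> inv
proof (induction l arbitrary: u a cs)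
  case 0
  then show ?case by simp
next
  case (Suc l)
  \<comment> \<open>The bound for the remaining \<open>l\<close> steps; averaging it over one step
    of the cover gives the bound for \<open>Suc l\<close>.\<close>
  define G where "G x = (\<integral>y. g y \<partial>cover_walk orc d l x)" for x
  have G: "0 \<le> G x" "G x \<le> B" for x
    unfolding G_def using g by (rule integral_bounded_pmf_nonneg integral_bounded_pmf_le)+
  define next_pmf where "next_pmf i = (case orc u i of
      None \<Rightarrow> return_pmf (u, a)
    | Some c \<Rightarrow> map_pmf (\<lambda>v. (v, a + offset c u + offset c v)) (pmf_of_set (constraint_vars c)))" for i
  have "accept orc (walk d (Suc l) u cs \<kappa>) \<le> (\<integral>i. (\<integral>x. G x \<partial>next_pmf i) \<partial>pmf_of_set {1..d})"
    unfolding walk.simps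
  proof (rule accept_Sample_le)
    fix i
    show "accept orc (Query u i (\<lambda>ans. case ans of None \<Rightarrow> walk d l u cs \<kappa>
        | Some c \<Rightarrow> Sample (pmf_of_set (constraint_vars c)) (\<lambda>v. walk d l v (c # cs) \<kappa>)))
      \<le> (\<integral>x. G x \<partial>next_pmf i)"
    proof (cases "orc u i")
      case None
      then show ?thesis using Suc by (simp add: next_pmf_def G_def)
    next
      case (Some c)
      have u: "u \<in> constraint_vars c" using orc[OF Some] .
      have "accept orc (Sample (pmf_of_set (constraint_vars c)) (\<lambda>v. walk d l v (c # cs) \<kappa>))
        \<le> (\<integral>v. G (v, a + offset c u + offset c v) \<partial>pmf_of_set (constraint_vars c))"
      proof (rule accept_Sample_le[where B = B])
        fix v assume "v \<in> set_pmf (pmf_of_set (constraint_vars c))"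
        moreover have "finite (constraint_vars c)" by (simp add: constraint_vars_def)
        ultimately have v: "v \<in> constraint_vars c" using u by (subst (asm) set_pmf_of_set) auto
        show "accept orc (walk d l v (c # cs) \<kappa>) \<le> G (v, a + offset c u + offset c v)"
          unfolding G_def
        proof (rule Suc.IH)
          fix w b cs'
          assume "set (c # cs) \<subseteq> set cs'" "\<And>\<sigma>. satisfies k \<sigma> cs' \<Longrightarrow> \<sigma> w = \<sigma> s + b"
          then show "accept orc (\<kappa> cs') \<le> g (w, b)" by (intro Suc.prems) auto
        next
          fix \<sigma> assume "satisfies k \<sigma> (c # cs)"
          then have "\<sigma> v = \<sigma> u + offset c u + offset c v" "\<sigma> u = \<sigma> s + a"
            using sat_constraint_edge[OF _ u v, of k \<sigma>] Suc.prems(2)[of \<sigma>]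
            by (simp_all only: satisfies_def list.set_intros set_simps insert_iff simp_thms) blast+
          then show "\<sigma> v = \<sigma> s + (a + offset c u + offset c v)"
            by (simp only: add.assoc)
        qed
      qed (rule G)+
      then show ?thesis using Some by (simp add: next_pmf_def)
    qed
  qed (use integral_bounded_pmf_nonneg[of G, OF G] integral_bounded_pmf_le[of G, OF G] in auto)
  also have "\<dots> = (\<integral>x. G x \<partial>cover_step orc d (u, a))"
    unfolding cover_step_def next_pmf_def[symmetric] case_prod_conv
    using G by (subst integral_bind_pmf[where B = B]) auto
  also have "\<dots> = (\<integral>x. g x \<partial>cover_walk orc d (Suc l) (u, a))"
    unfolding G_def cover_walk.simps
    using g by (subst integral_bind_pmf[where B = B]) auto
  finally show ?case .
qed

subsection \<open>Collisions of walks\<close>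

lemma satisfies_mono: "satisfies k \<sigma> cs' \<Longrightarrow> set cs \<subseteq> set cs' \<Longrightarrow> satisfies k \<sigma> cs"
  by (auto simp: satisfies_def)

context
  fixes orc :: "nat \<Rightarrow> nat \<Rightarrow> equ_constraint option" and d k l s :: nat
    and \<kappa> :: "equ_constraint list \<Rightarrow> query_alg" and A :: real
  assumes orc: "\<And>x i c. orc x i = Some c \<Longrightarrow> x \<in> constraint_vars c"
    and A: "\<And>cs. accept orc (\<kappa> cs) \<le> A"
    and reject: "\<And>cs. \<nexists>\<sigma>. satisfies k \<sigma> cs \<Longrightarrow> accept orc (\<kappa> cs) = 0"
begin

private lemma bound_nonneg: "0 \<le> A" using A[of "[]"] accept_nonneg[of orc "\<kappa> []"] by linarith

text \<open>Further constraints cannot restore satisfiability, so \<open>accept_walk_le\<close>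
  applies with the zero function as \<open>g\<close>.\<close>

lemma accept_walks_inconsistent:
  assumes "\<nexists>\<sigma>. satisfies k \<sigma> cs"
  shows "accept orc (walks d l s m cs \<kappa>) = 0"
  using assms
proof (induction m arbitrary: cs)
  case 0
  then show ?case using reject by simp
next
  case (Suc m)
  have "accept orc (walk d l s cs (\<lambda>cs'. walks d l s m cs' \<kappa>)) \<le> (\<integral>x. 0 \<partial>cover_walk orc d l (s, 0))"
  proof (rule accept_walk_le[where B = 0 and s = s, OF orc])
    fix cs' assume "set cs \<subseteq> set cs'"
    then have "\<nexists>\<sigma>. satisfies k \<sigma> cs'" using Suc.prems satisfies_mono by blast
    then show "accept orc (walks d l s m cs' \<kappa>) \<le> 0" using Suc.IH by simp
  qed auto
  then show ?case using accept_nonneg[of orc "walks d l s (Suc m) cs \<kappa>"] by simp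
qed

lemma accept_scan_inconsistent:
  assumes "i0 \<in> {1..i}" "orc u i0 = Some c" "\<nexists>\<sigma>. sat_constraint k \<sigma> c"
  shows "accept orc (scan u i cs (\<lambda>cs. walks d l s m cs \<kappa>)) = 0"
proof -
  have *: "accept orc (scan u i cs (\<lambda>cs. walks d l s m cs \<kappa>)) = 0" if "c \<in> set cs" for i cs
    using that
  proof (induction i arbitrary: cs)
    case 0
    then have "\<nexists>\<sigma>. satisfies k \<sigma> cs" using assms(3) unfolding satisfies_def by blast
    then show ?case by (simp add: accept_walks_inconsistent)
  qed (auto split: option.split)
  show ?thesis using assms(1)
  proof (induction i arbitrary: cs)
    case (Suc i)
    show ?case
    proof (cases "i0 = Suc i")
      case True
      then show ?thesis using assms(2) * by simp
    next
      case False
      then show ?thesis using Suc by simp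
    qed
  qed simp
qed

lemma accept_walks_le:
  "accept orc (walks d l s m cs \<kappa>) \<le> A"
proof (induction m arbitrary: cs)
  case 0
  then show ?case using A by simp
next
  case (Suc m)
  have "accept orc (walk d l s cs (\<lambda>cs'. walks d l s m cs' \<kappa>)) \<le> (\<integral>x. A \<partial>cover_walk orc d l (s, 0))"
    by (rule accept_walk_le[where B = A and k = k and s = s, OF orc]) (auto simp: Suc bound_nonneg)
  then show ?case by simp
qed

lemma accept_scan_le: "accept orc (scan u i cs (\<lambda>cs. walks d l s m cs \<kappa>)) \<le> A"
  by (induction i arbitrary: cs) (auto simp: accept_walks_le)

text \<open>Phrased through satisfying assignments rather than through the walks themselves, so that
  it survives the addition of constraints.\<close>

private definition "seen S cs \<longleftrightarrow> (\<forall>v\<in>S. \<forall>\<sigma>. satisfies k \<sigma> cs \<longrightarrow> \<sigma> v = \<sigma> s)"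

text \<open>A walk ending in \<open>S\<close> with parity 1 forces both
  \<open>\<sigma> v = \<sigma> s\<close> and \<open>\<sigma> v = \<sigma> s + 1\<close>. Each of the
  \<open>m\<close> independent walks has a fresh chance of this.\<close>

lemma accept_second_batch:
  assumes "seen S cs"
  shows "accept orc (walks d l s m cs \<kappa>)
     \<le> A * (1 - measure_pmf.prob (cover_walk orc d l (s, 0)) (S \<times> {1})) ^ m"
  using assms
proof (induction m arbitrary: cs)
  case 0
  then show ?case using A by simp
next
  case (Suc m)
  define p where "p = cover_walk orc d l (s, 0)"
  define B where "B = A * (1 - measure_pmf.prob p (S \<times> {1})) ^ m"
  have B: "0 \<le> B" by (simp add: B_def bound_nonneg)
  have "accept orc (walk d l s cs (\<lambda>cs'. walks d l s m cs' \<kappa>))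
    \<le> (\<integral>x. B * indicat_real (- (S \<times> {1})) x \<partial>p)"
    unfolding p_def
  proof (rule accept_walk_le[where B = B and s = s and k = k, OF orc])
    fix v b cs' assume cs': "set cs \<subseteq> set cs'" "\<And>\<sigma>. satisfies k \<sigma> cs' \<Longrightarrow> \<sigma> v = \<sigma> s + b"
    have sub: "satisfies k \<sigma> cs" if "satisfies k \<sigma> cs'" for \<sigma>
      using satisfies_mono[OF that cs'(1)] .
    then have "seen S cs'" using Suc.prems by (auto simp: seen_def)
    then have le: "accept orc (walks d l s m cs' \<kappa>) \<le> B" using Suc.IH by (simp add: B_def p_def)
    show "accept orc (walks d l s m cs' \<kappa>) \<le> B * indicat_real (- (S \<times> {1})) (v, b)"
    proof (cases "(v, b) \<in> S \<times> {1}")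
      case True
      have "\<nexists>\<sigma>. satisfies k \<sigma> cs'"
      proof
        assume "\<exists>\<sigma>. satisfies k \<sigma> cs'"
        then obtain \<sigma> where \<sigma>: "satisfies k \<sigma> cs'" ..
        then have "\<sigma> v = \<sigma> s" "\<sigma> v = \<sigma> s + b" using True sub Suc.prems cs'(2) by (auto simp: seen_def)
        then show False using True by (cases "\<sigma> s") auto
      qed
      then show ?thesis using True accept_walks_inconsistent by simp
    qed (use le in simp)
  qed (use B in \<open>auto simp: indicator_def\<close>)
  also have "\<dots> = B * measure_pmf.prob p (- (S \<times> {1}))" by simp
  also have "measure_pmf.prob p (- (S \<times> {1})) = 1 - measure_pmf.prob p (S \<times> {1})"
    using measure_pmf.prob_compl[of "S \<times> {1}" p] by (simp add: Compl_eq_Diff_UNIV)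
  finally show ?case by (simp add: B_def p_def mult_ac)
qed

section \<open>Birthday argument for two batches of walks\<close>

context
  fixes n m :: nat and p :: "(nat \<times> bit) pmf" and \<mu> :: "nat \<Rightarrow> real"
  assumes n: "0 < n" and m: "80 * sqrt n \<le> m"
    and p_def: "p = cover_walk orc d l (s, 0)"
    and \<mu>_def: "\<mu> = (\<lambda>v. min (pmf p (v, 0)) (pmf p (v, 1)))"
    and mass: "1 / 8 \<le> (\<Sum>v<n. \<mu> v)"
begin

private lemma \<mu>_nonneg: "0 \<le> \<mu> v" by (simp add: \<mu>_def)

private lemma m_ge: "80 \<le> real m"
proof -
  have "1 \<le> sqrt n" using n by simp
  then show ?thesis using m by linarith
qed

text \<open>\<open>S\<close> is the set of end points already seen with parity 0. The sum is the relative expected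
  decrease of the potential \<open>exp (- m * \<mu>(S))\<close> caused by one more walk.\<close>

lemma fresh_visit:
  assumes S: "S \<subseteq> {..<n}" "(\<Sum>v\<in>S. \<mu> v) \<le> 1 / 16"
  shows "2 / real m \<le> (\<Sum>v\<in>{..<n} - S. \<mu> v * (1 - exp (- real m * \<mu> v)))"
proof -
  define c where "c = 1 / sqrt n"
  have sqrt: "1 \<le> sqrt n" using n by simp
  have c: "0 < c" "c \<le> 1" using sqrt by (auto simp: c_def)
  have exp_c: "c / 2 \<le> 1 - exp (- c)"
  proof -
    have "exp (- c) \<le> 1 / (1 + c)"
      using exp_ge_add_one_self[of c] c by (simp add: exp_minus field_simps)
    also have "\<dots> \<le> 1 - c / 2"
    proof -
      have "1 \<le> (1 - c / 2) * (1 + c)" using c mult_left_mono[of c 1 c] by (simp add: algebra_simps)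
      then show ?thesis using c by (simp add: divide_le_eq)
    qed
    finally show ?thesis by simp
  qed
  \<comment> \<open>A linear lower bound, so that only the total mass outside \<open>S\<close>
    matters. The choice \<open>c = 1 / sqrt n\<close> limits the total loss over at most
    \<open>n\<close> variables to \<open>n * c = sqrt n\<close>.\<close>
  have tangent: "(y - c) * (c / 2) \<le> y * (1 - exp (- y))" if "0 \<le> y" for y
  proof (cases "c \<le> y")
    case True
    have "(y - c) * (c / 2) \<le> y * (1 - exp (- c))"
      using True c exp_c by (intro mult_mono) auto
    also have "\<dots> \<le> y * (1 - exp (- y))" using True that by (intro mult_left_mono) auto
    finally show ?thesis .
  next
    case False
    then have "(y - c) * (c / 2) \<le> 0" using c by (intro mult_nonpos_nonneg) auto
    also have "0 \<le> y * (1 - exp (- y))" using that by simp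
    finally show ?thesis .
  qed
  have rest: "1 / 16 \<le> (\<Sum>v\<in>{..<n} - S. \<mu> v)"
    using S mass by (simp add: sum_diff)
  have "card ({..<n} - S) \<le> card {..<n}" by (intro card_mono) auto
  then have card: "real (card ({..<n} - S)) * c \<le> sqrt n"
    using c n by (simp add: c_def field_simps)
  \<comment> \<open>Source of the constant 80: \<open>m / 16 - sqrt n\<close> is at least
    \<open>4 * sqrt n\<close>, and \<open>c / 2 = 1 / (2 * sqrt n)\<close>.\<close>
  have "2 \<le> (m / 16 - sqrt n) * (c / 2)"
    using m n by (simp add: c_def field_simps)
  also have "\<dots> \<le> (m * (\<Sum>v\<in>{..<n} - S. \<mu> v) - card ({..<n} - S) * c) * (c / 2)"
    using c card mult_left_mono[OF rest, of m] by (intro mult_right_mono) auto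
  also have "\<dots> = (\<Sum>v\<in>{..<n} - S. (m * \<mu> v - c) * (c / 2))"
    by (subst sum_distrib_right[symmetric]) (simp add: sum_subtractf sum_distrib_left)
  also have "\<dots> \<le> (\<Sum>v\<in>{..<n} - S. (m * \<mu> v) * (1 - exp (- (m * \<mu> v))))"
    using \<mu>_nonneg by (intro sum_mono tangent) simp
  also have "\<dots> = m * (\<Sum>v\<in>{..<n} - S. \<mu> v * (1 - exp (- real m * \<mu> v)))"
    by (simp add: sum_distrib_left mult.assoc)
  finally show ?thesis using m_ge by (simp add: divide_le_eq mult.commute)
qed

text \<open>The mass of \<open>\<mu>\<close> on \<open>S\<close> bounds the probability of ending in
  \<open>S\<close> with parity 1 from below. Any \<open>j \<ge> m\<close> is allowed because the
  first batch may be cut short, leaving more than \<open>m\<close> walks.\<close>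

lemma accept_second_batch_exp:
  assumes "seen S cs" "S \<subseteq> {..<n}" "m \<le> j"
  shows "accept orc (walks d l s j cs \<kappa>) \<le> A * exp (- real m * (\<Sum>v\<in>S. \<mu> v))"
proof -
  let ?q = "measure_pmf.prob p (S \<times> {1})"
  have \<mu>_le: "(\<Sum>v\<in>S. \<mu> v) \<le> ?q"
  proof -
    have "finite S" using assms(2) finite_subset by blast
    then have "?q = (\<Sum>v\<in>S. pmf p (v, 1))"
      by (simp add: measure_measure_pmf_finite sum.cartesian_product')
    then show ?thesis by (simp add: \<mu>_def sum_mono)
  qed
  have "accept orc (walks d l s j cs \<kappa>) \<le> A * (1 - ?q) ^ j"
    using accept_second_batch[OF assms(1)] by (simp add: p_def)
  also have "\<dots> \<le> A * exp (- real m * (\<Sum>v\<in>S. \<mu> v))"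
  proof (rule mult_left_mono[OF _ bound_nonneg])
    have "(1 - ?q) ^ j \<le> (1 - ?q) ^ m" using assms(3) by (intro power_decreasing) auto
    also have "1 - ?q \<le> exp (- (\<Sum>v\<in>S. \<mu> v))"
      using exp_ge_add_one_self[of "- (\<Sum>v\<in>S. \<mu> v)"] \<mu>_le by linarith
    then have "(1 - ?q) ^ m \<le> exp (- (\<Sum>v\<in>S. \<mu> v)) ^ m"
      by (intro power_mono) auto
    finally show "(1 - ?q) ^ j \<le> exp (- real m * (\<Sum>v\<in>S. \<mu> v))"
      by (simp flip: exp_of_nat_mult)
  qed
  finally show ?thesis .
qed

text \<open>While \<open>S\<close> has mass at most 1/16, \<open>fresh_visit\<close> shrinks the
  expected potential by the factor \<open>1 - 2 / m\<close> per walk. Once the mass exceeds 1/16,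
  the remaining walks already reject well enough, which the term \<open>exp (- m / 16)\<close>
  covers.\<close>

lemma accept_first_batch:
  assumes "seen S cs" "S \<subseteq> {..<n}"
  shows "accept orc (walks d l s (i + m) cs \<kappa>)
     \<le> A * ((1 - 2 / real m) ^ i * exp (- real m * (\<Sum>v\<in>S. \<mu> v)) + exp (- real m / 16))"
  using assms
proof (induction i arbitrary: S cs)
  case 0
  have "A * exp (- real m * (\<Sum>v\<in>S. \<mu> v)) \<le> A * (exp (- real m * (\<Sum>v\<in>S. \<mu> v)) + exp (- real m / 16))"
    by (intro mult_left_mono bound_nonneg) auto
  then show ?case using accept_second_batch_exp[OF 0 order_refl] by simp
next
  case (Suc i)
  have fac: "0 \<le> 1 - 2 / real m" "1 - 2 / real m \<le> 1" using m_ge by auto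
  show ?case
  proof (cases "(\<Sum>v\<in>S. \<mu> v) \<le> 1 / 16")
    case False
    have "accept orc (walks d l s (Suc i + m) cs \<kappa>) \<le> A * exp (- real m * (\<Sum>v\<in>S. \<mu> v))"
      by (rule accept_second_batch_exp[OF Suc.prems]) simp
    also have "\<dots> \<le> A * ((1 - 2 / real m) ^ Suc i * exp (- real m * (\<Sum>v\<in>S. \<mu> v)) + exp (- real m / 16))"
    proof (rule mult_left_mono[OF _ bound_nonneg])
      have "m * (1 / 16) \<le> m * (\<Sum>v\<in>S. \<mu> v)" using False by (intro mult_left_mono) auto
      then have "exp (- real m * (\<Sum>v\<in>S. \<mu> v)) \<le> exp (- real m / 16)" by simp
      moreover have "0 \<le> (1 - 2 / real m) ^ Suc i * exp (- real m * (\<Sum>v\<in>S. \<mu> v))" using fac by simp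
      ultimately show "exp (- real m * (\<Sum>v\<in>S. \<mu> v))
          \<le> (1 - 2 / real m) ^ Suc i * exp (- real m * (\<Sum>v\<in>S. \<mu> v)) + exp (- real m / 16)" by linarith
    qed
    finally show ?thesis .
  next
    case True
    define \<phi> where "\<phi> T = exp (- real m * (\<Sum>v\<in>T. \<mu> v))" for T
    define ext where "ext x = (if x \<in> ({..<n} - S) \<times> {0} then insert (fst x) S else S)" for x :: "nat \<times> bit"
    \<comment> \<open>The factor by which the potential changes when \<open>S\<close> grows to
      \<open>ext x\<close>.\<close>
    define h where "h x = (if x \<in> ({..<n} - S) \<times> {0} then exp (- real m * \<mu> (fst x)) else 1)" for x :: "nat \<times> bit"
    have bit: "of_bool (b = 1) = b" for b :: bit by (cases b) auto
    have fin: "finite S" using Suc.prems finite_subset by blast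
    have \<phi>_le: "\<phi> T \<le> 1" for T using \<mu>_nonneg by (simp add: \<phi>_def sum_nonneg)
    have \<phi>_ext: "\<phi> (ext x) = \<phi> S * h x" for x
      using fin by (auto simp: \<phi>_def ext_def h_def algebra_simps simp flip: exp_add)
    have h: "0 \<le> h x" "h x \<le> 1" for x using \<mu>_nonneg by (auto simp: h_def)
    have "accept orc (walk d l s cs (\<lambda>cs'. walks d l s (i + m) cs' \<kappa>))
      \<le> (\<integral>x. A * ((1 - 2 / real m) ^ i * \<phi> (ext x) + exp (- real m / 16)) \<partial>p)"
      unfolding p_def
    proof (rule accept_walk_le[where B = "A * 2" and s = s and k = k, OF orc])
      fix v b cs' assume cs': "set cs \<subseteq> set cs'" "\<And>\<sigma>. satisfies k \<sigma> cs' \<Longrightarrow> \<sigma> v = \<sigma> s + b"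
      have "satisfies k \<sigma> cs" if "satisfies k \<sigma> cs'" for \<sigma>
        using satisfies_mono[OF that cs'(1)] .
      then have "seen (ext (v, b)) cs'"
        using Suc.prems cs'(2) bit by (auto simp: seen_def ext_def)
      moreover have "ext (v, b) \<subseteq> {..<n}" using Suc.prems by (auto simp: ext_def)
      ultimately show "accept orc (walks d l s (i + m) cs' \<kappa>)
        \<le> A * ((1 - 2 / real m) ^ i * \<phi> (ext (v, b)) + exp (- real m / 16))"
        unfolding \<phi>_def by (rule Suc.IH)
    next
      fix x
      have "(1 - 2 / real m) ^ i * \<phi> (ext x) \<le> 1 * 1"
        using fac \<phi>_le by (intro mult_mono power_le_one) (auto simp: \<phi>_def)
      then show "A * ((1 - 2 / real m) ^ i * \<phi> (ext x) + exp (- real m / 16)) \<le> A * 2"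
        using exp_le_one_iff[of "- real m / 16"] m_ge by (intro mult_left_mono bound_nonneg) linarith
      show "0 \<le> A * ((1 - 2 / real m) ^ i * \<phi> (ext x) + exp (- real m / 16))"
        using fac bound_nonneg by (simp add: \<phi>_def)
    qed auto
    also have "\<dots> = A * ((1 - 2 / real m) ^ i * \<phi> S * (\<integral>x. h x \<partial>p) + exp (- real m / 16))"
      using integrable_bounded_pmf[of h, OF h]
      by (simp add: \<phi>_ext mult.assoc)
    also have "\<dots> \<le> A * ((1 - 2 / real m) ^ i * \<phi> S * (1 - 2 / real m) + exp (- real m / 16))"
    proof (intro mult_left_mono bound_nonneg add_right_mono)
      have "(\<integral>x. 1 - h x \<partial>p) = (\<Sum>x\<in>({..<n} - S) \<times> {0}. pmf p x * (1 - h x))"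
        by (subst integral_measure_pmf[where A = "({..<n} - S) \<times> {0}"]) (auto simp: h_def split: if_splits)
      also have "\<dots> = (\<Sum>v\<in>{..<n} - S. pmf p (v, 0) * (1 - exp (- real m * \<mu> v)))"
        unfolding sum.cartesian_product' by (intro sum.cong) (auto simp: h_def split: if_splits)
      also have "\<dots> \<ge> (\<Sum>v\<in>{..<n} - S. \<mu> v * (1 - exp (- real m * \<mu> v)))"
        using \<mu>_nonneg by (intro sum_mono mult_right_mono) (auto simp: \<mu>_def)
      finally have "2 / real m \<le> (\<integral>x. 1 - h x \<partial>p)"
        using fresh_visit[OF Suc.prems(2) True] by linarith
      then show "(\<integral>x. h x \<partial>p) \<le> 1 - 2 / real m"
        using integrable_bounded_pmf[of h, OF h] by simp
    qed (use fac in \<open>auto simp: \<phi>_def\<close>)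
    finally show ?thesis by (simp add: \<phi>_def mult_ac)
  qed
qed

text \<open>Starting from \<open>S = {}\<close>, the first term is at most
  \<open>exp (- 2) \<le> 1 / 3\<close>, and \<open>m \<ge> 80\<close> makes the second at most
  \<open>exp (- 5) \<le> 1 / 6\<close>.\<close>

lemma accept_walks_le_half: "accept orc (walks d l s (2 * m) cs \<kappa>) \<le> A / 2"
proof -
  have exp_le: "exp (- 2) \<le> (1 / 3 :: real)" "exp (- 5) \<le> (1 / 6 :: real)"
    using exp_ge_add_one_self[of 2] exp_ge_add_one_self[of 5] by (auto simp: exp_minus field_simps)
  have "accept orc (walks d l s (m + m) cs \<kappa>)
     \<le> A * ((1 - 2 / real m) ^ m * exp (- real m * (\<Sum>v\<in>{}. \<mu> v)) + exp (- real m / 16))"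
    by (rule accept_first_batch) (auto simp: seen_def)
  also have "\<dots> \<le> A * (1 / 3 + 1 / 6)"
  proof (intro mult_left_mono add_mono bound_nonneg)
    have "1 - 2 / real m \<le> exp (- (2 / real m))" using exp_ge_add_one_self[of "- (2 / real m)"] by simp
    then have "(1 - 2 / real m) ^ m \<le> exp (- (2 / real m)) ^ m" using m_ge by (intro power_mono) auto
    also have "\<dots> = exp (- 2)" using m_ge by (simp flip: exp_of_nat_mult)
    finally show "(1 - 2 / real m) ^ m * exp (- real m * (\<Sum>v\<in>{}. \<mu> v)) \<le> 1 / 3" using exp_le by simp
    have "exp (- real m / 16) \<le> exp (- 5 :: real)" using m_ge by simp
    then show "exp (- real m / 16) \<le> (1 / 6 :: real)" using exp_le by linarith
  qed
  finally show ?thesis by (simp flip: mult_2)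
qed

end

end

subsection \<open>Soundness of the tester relative to good start vertices\<close>

definition overlap :: "nat \<Rightarrow> (nat \<times> bit) pmf \<Rightarrow> real" where
  "overlap n p = (\<Sum>v<n. min (pmf p (v, 0)) (pmf p (v, 1)))"

text \<open>The start lies in \<open>B\<close> with probability \<open>card B / n\<close> and the
  length is \<open>l0\<close> with probability \<open>1 / L\<close>; in that event the bound
  \<open>A\<close> is halved, otherwise it is kept.\<close>

lemma accept_round_le:
  fixes orc :: "nat \<Rightarrow> nat \<Rightarrow> equ_constraint option" and A :: real
  assumes orc: "\<And>x i c. orc x i = Some c \<Longrightarrow> x \<in> constraint_vars c"
    and A: "\<And>cs. accept orc (\<kappa> cs) \<le> A"
    and reject: "\<And>cs. \<nexists>\<sigma>. satisfies k \<sigma> cs \<Longrightarrow> accept orc (\<kappa> cs) = 0"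
    and n: "0 < n" and m: "80 * sqrt n \<le> m" and l0: "l0 < L" and B: "B \<subseteq> {..<n}"
    and bad: "\<And>s. s \<in> B \<Longrightarrow> (\<exists>i\<in>{1..d}. \<exists>c. orc s i = Some c \<and> (\<nexists>\<sigma>. sat_constraint k \<sigma> c))
       \<or> 1 / 8 \<le> overlap n (cover_walk orc d l0 (s, 0))"
  shows "accept orc (test_round n d L m \<kappa>) \<le> A * (1 - real (card B) / (2 * real n * real L))"
proof -
  have A0: "0 \<le> A" using A[of "[]"] accept_nonneg[of orc "\<kappa> []"] by linarith
  define g where "g s l = (if s \<in> B \<and> l = l0 then A / 2 else A)" for s l :: nat
  have g: "0 \<le> g s l" "g s l \<le> A" for s l using A0 by (auto simp: g_def)
  have le: "accept orc (scan s d [] (\<lambda>cs. walks d l s (2 * m) cs \<kappa>)) \<le> g s l" for s l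
  proof (cases "s \<in> B \<and> l = l0")
    case True
    from bad[of s] True consider
        i c where "i \<in> {1..d}" "orc s i = Some c" "\<nexists>\<sigma>. sat_constraint k \<sigma> c"
      | "1 / 8 \<le> overlap n (cover_walk orc d l0 (s, 0))" by blast
    then have "accept orc (scan s d [] (\<lambda>cs. walks d l s (2 * m) cs \<kappa>)) \<le> A / 2"
    proof cases
      case 1
      then show ?thesis using accept_scan_inconsistent[OF orc A reject 1] A0 by simp
    next
      case 2
      have half: "accept orc (walks d l s (2 * m) cs \<kappa>) \<le> A / 2" for cs
        using accept_walks_le_half[OF orc A reject n m refl refl] 2 True by (simp add: overlap_def)
      have "accept orc (scan s i cs (\<lambda>cs. walks d l s (2 * m) cs \<kappa>)) \<le> A / 2" for i cs
        by (induction i arbitrary: cs) (simp_all add: half del: le_divide_eq_numeral1)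
      then show ?thesis .
    qed
    then show ?thesis using True by (simp add: g_def)
  next
    case False
    then show ?thesis using accept_scan_le[OF orc A reject] by (auto simp: g_def)
  qed
  have int_l: "(\<integral>l. g s l \<partial>pmf_of_set {..<L}) = A - indicat_real B s * (A / (2 * L))" for s
  proof -
    have "(\<integral>l. g s l \<partial>pmf_of_set {..<L}) = (\<Sum>l<L. g s l) / L"
      using l0 by (subst integral_pmf_of_set) auto
    also have "(\<Sum>l<L. g s l) = L * A - indicat_real B s * (A / 2)"
    proof -
      have "(\<Sum>l<L. g s l) = (\<Sum>l<L. A - (if l = l0 then indicat_real B s * (A / 2) else 0))"
        by (intro sum.cong) (auto simp: g_def)
      then show ?thesis using l0 by (simp add: sum_subtractf)
    qed
    finally show ?thesis using l0 by (simp add: field_simps)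
  qed
  have "accept orc (test_round n d L m \<kappa>) \<le> (\<integral>s. (\<integral>l. g s l \<partial>pmf_of_set {..<L}) \<partial>pmf_of_set {..<n})"
    unfolding test_round_def
    using integral_bounded_pmf_nonneg[of "g _", OF g] integral_bounded_pmf_le[of "g _", OF g]
    by (intro accept_Sample_le le) (auto intro: g)
  also have "\<dots> = (\<Sum>s<n. A - indicat_real B s * (A / (2 * L))) / n"
    unfolding int_l using n by (subst integral_pmf_of_set) auto
  also have "(\<Sum>s<n. A - indicat_real B s * (A / (2 * L))) = n * A - card B * (A / (2 * L))"
  proof -
    have "(\<Sum>s<n. indicat_real B s) = card B"
      using B by (simp add: indicator_def sum.If_cases Int_absorb1)
    then show ?thesis unfolding sum_subtractf sum_distrib_right[symmetric] by simp
  qed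
  also have "(n * A - card B * (A / (2 * L))) / n = A * (1 - real (card B) / (2 * real n * real L))"
    using n by (simp add: field_simps)
  finally show ?thesis .
qed

lemma accept_tester_le:
  fixes orc :: "nat \<Rightarrow> nat \<Rightarrow> equ_constraint option"
  assumes orc: "\<And>x i c. orc x i = Some c \<Longrightarrow> x \<in> constraint_vars c"
    and n: "0 < n" and m: "80 * sqrt n \<le> m" and l0: "l0 < L" and B: "B \<subseteq> {..<n}"
    and bad: "\<And>s. s \<in> B \<Longrightarrow> (\<exists>i\<in>{1..d}. \<exists>c. orc s i = Some c \<and> (\<nexists>\<sigma>. sat_constraint k \<sigma> c))
       \<or> 1 / 8 \<le> overlap n (cover_walk orc d l0 (s, 0))"
  shows "accept orc (tester k n d L m R) \<le> (1 - real (card B) / (2 * real n * real L)) ^ R"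
proof (induction R)
  case (Suc R)
  have "card B \<le> n" using card_mono[OF _ B] by simp
  also have "n \<le> n * L" using l0 by simp
  finally have "card B \<le> n * L" .
  then have nonneg: "0 \<le> 1 - real (card B) / (2 * real n * real L)"
  proof -
    have "real (card B) \<le> real n * real L"
      using \<open>card B \<le> n * L\<close> by (simp flip: of_nat_mult)
    also have "\<dots> \<le> 2 * real n * real L" by simp
    finally show ?thesis using n l0 by (simp add: divide_le_eq)
  qed
  have "accept orc (tester k n d L m (Suc R))
      \<le> (1 - real (card B) / (2 * real n * real L)) ^ R * (1 - real (card B) / (2 * real n * real L))"
    unfolding tester.simps
  proof (rule accept_round_le[OF orc _ _ n m l0 B bad])
    show "accept orc (if \<exists>\<sigma>. satisfies k \<sigma> cs then tester k n d L m R else Verdict False)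
        \<le> (1 - real (card B) / (2 * real n * real L)) ^ R" for cs
      using Suc nonneg by simp
  qed auto
  then show ?case by (simp add: mult.commute)
qed simp

subsection \<open>The double cover of an instance\<close>

lemma UNIV_bit: "(UNIV :: bit set) = {0, 1}"
proof -
  have "b \<in> {0, 1}" for b :: bit by (cases b) auto
  then show ?thesis by blast
qed

instance bit :: finite
  by standard (simp add: UNIV_bit)

lemma bit_add_swap: "b = a + s + t \<longleftrightarrow> a = b + t + s" for a b s t :: bit
  by (cases a; cases b; cases s; cases t) auto

lemma pmf_map_graph_pmf_of_set:
  assumes "finite A" "A \<noteq> {}"
  shows "pmf (map_pmf (\<lambda>v. (v, g v)) (pmf_of_set A)) (v, b) = of_bool (v \<in> A \<and> b = g v) / card A"
proof -
  have "A \<inter> (\<lambda>v. (v, g v)) -` {(v, b)} = (if v \<in> A \<and> b = g v then {v} else {})" by auto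
  then show ?thesis using assms by (simp add: pmf_map measure_pmf_of_set)
qed

text \<open>The deck transformation of the double cover. The walk commutes with it, so changing the
  sheet of the start negates all biases.\<close>

definition flip :: "nat \<times> bit \<Rightarrow> nat \<times> bit" where
  "flip x = (fst x, snd x + 1)"

lemma cover_step_flip: "cover_step orc d (flip x) = map_pmf flip (cover_step orc d x)"
proof (cases x)
  case (Pair u a)
  have swap: "a + 1 + s + t = a + s + t + 1" for s t :: bit by (simp only: add_ac)
  show ?thesis
    unfolding Pair cover_step_def flip_def fst_conv snd_conv case_prod_conv map_bind_pmf
  proof (rule bind_pmf_cong[OF refl])
    fix i
    show "(case orc u i of None \<Rightarrow> return_pmf (u, a + 1)
        | Some c \<Rightarrow> map_pmf (\<lambda>v. (v, a + 1 + offset c u + offset c v)) (pmf_of_set (constraint_vars c)))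
      = map_pmf (\<lambda>x. (fst x, snd x + 1)) (case orc u i of None \<Rightarrow> return_pmf (u, a)
        | Some c \<Rightarrow> map_pmf (\<lambda>v. (v, a + offset c u + offset c v)) (pmf_of_set (constraint_vars c)))"
      by (cases "orc u i") (simp_all only: option.case map_return_pmf pmf.map_comp o_def fst_conv snd_conv swap)
  qed
qed

lemma cover_walk_flip: "cover_walk orc d l (flip x) = map_pmf flip (cover_walk orc d l x)"
  by (induction l arbitrary: x) (simp_all add: cover_step_flip bind_map_pmf map_bind_pmf)

lemma flip_inj: "inj flip"
  by (auto simp: inj_on_def flip_def)

lemma pmf_cover_walk_flip: "pmf (cover_walk orc d l (flip x)) (flip y) = pmf (cover_walk orc d l x) y"
  by (simp add: cover_walk_flip pmf_map_inj' flip_inj)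

definition bias :: "(nat \<times> bit) pmf \<Rightarrow> nat \<Rightarrow> real" where
  "bias p s = pmf p (s, 0) - pmf p (s, 1)"

lemma abs_bias_le_1: "\<bar>bias p s\<bar> \<le> 1"
  using pmf_le_1[of p "(s, 0)"] pmf_le_1[of p "(s, 1)"] pmf_nonneg[of p "(s, 0)"] pmf_nonneg[of p "(s, 1)"]
  unfolding bias_def by linarith

lemma bias_cover_walk_1: "bias (cover_walk orc d l (v, 1)) s = - bias (cover_walk orc d l (v, 0)) s"
  using pmf_cover_walk_flip[of orc d l "(v, 0)" "(s, 0)"] pmf_cover_walk_flip[of orc d l "(v, 0)" "(s, 1)"]
  by (simp add: bias_def flip_def)

locale instance_walk =
  fixes I :: equ_inst and k d n :: nat
  assumes I: "I \<in> equ_insts k d n" and k: "0 < k" and d: "0 < d" and n: "0 < n"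
begin

abbreviation "orc \<equiv> equ_oracle I"
abbreviation "M \<equiv> length (constrs I)"
abbreviation "con j \<equiv> constrs I ! j"
abbreviation "V j \<equiv> constraint_vars (con j)"
abbreviation "W \<equiv> cover_walk orc d"

lemma V: "j < M \<Longrightarrow> V j \<subseteq> {..<n}" "j < M \<Longrightarrow> V j \<noteq> {}" "finite (V j)"
proof -
  assume "j < M"
  then have "con j \<in> set (constrs I)" by simp
  then have "length (con j) = k" "V j \<subseteq> {..<n}" using I by (auto simp: equ_insts_def)
  then show "V j \<subseteq> {..<n}" "V j \<noteq> {}" using k by (auto simp: constraint_vars_def)
qed (simp add: constraint_vars_def)

lemma incident: "distinct (incident I x)" "set (incident I x) = {j. j < M \<and> x \<in> V j}"
  "length (incident I x) \<le> d"
  using I by (auto simp: equ_insts_def)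

lemma orc_SomeD:
  assumes "orc x i = Some c" shows "\<exists>j<M. c = con j \<and> x \<in> V j"
proof -
  from assms have "i - 1 < length (incident I x)" "c = con (incident I x ! (i - 1))"
    by (auto simp: equ_oracle_def split: if_splits)
  then show ?thesis using incident(2)[of x] nth_mem[of "i - 1" "incident I x"] by auto
qed

lemma orc_ex:
  assumes "j < M" "x \<in> V j" shows "\<exists>i\<in>{1..d}. orc x i = Some (con j)"
proof -
  from assms obtain i where i: "i < length (incident I x)" "incident I x ! i = j"
    using incident(2)[of x] by (metis (mono_tags, lifting) in_set_conv_nth mem_Collect_eq)
  then have "orc x (Suc i) = Some (con j)" by (simp add: equ_oracle_def)
  then show ?thesis using i incident(3)[of x] by (intro bexI[of _ "Suc i"]) auto
qed

text \<open>The share of constraint \<open>j\<close> in \<open>d\<close> times the transition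
  probability. Unlike the description by oracle indices it is visibly symmetric in the two
  states.\<close>

definition edge :: "nat \<Rightarrow> nat \<times> bit \<Rightarrow> nat \<times> bit \<Rightarrow> real" where
  "edge j x z = of_bool (fst x \<in> V j \<and> fst z \<in> V j
     \<and> snd z = snd x + offset (con j) (fst x) + offset (con j) (fst z)) / card (V j)"

lemma edge_nonneg: "0 \<le> edge j x z" by (simp add: edge_def)

lemma edge_sym: "edge j x z = edge j z x"
  using bit_add_swap[of "snd z" "snd x"] by (auto simp: edge_def)

text \<open>The answered indices at a variable enumerate its constraints bijectively, because
  \<open>incident\<close> is distinct; the remaining indices up to \<open>d\<close> give the
  self-loop.\<close>

lemma pmf_cover_step:
  "pmf (cover_step orc d x) z
    = ((\<Sum>j<M. edge j x z) + (d - length (incident I (fst x))) * of_bool (x = z)) / d"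
proof -
  obtain u a where x: "x = (u, a)" by (cases x)
  obtain v b where z: "z = (v, b)" by (cases z)
  let ?inc = "incident I u"
  define F where "F i = pmf (case orc u i of None \<Rightarrow> return_pmf (u, a)
    | Some c \<Rightarrow> map_pmf (\<lambda>v. (v, a + offset c u + offset c v)) (pmf_of_set (constraint_vars c))) z" for i
  have in_range: "F (Suc i) = edge (?inc ! i) x z" if "i < length ?inc" for i
  proof -
    have *: "?inc ! i < M" "u \<in> V (?inc ! i)" using incident(2)[of u] nth_mem[OF that] by auto
    have "orc u (Suc i) = Some (con (?inc ! i))" using that by (simp add: equ_oracle_def)
    then show ?thesis
      using V(2)[OF *(1)] V(3)[of "?inc ! i"] *(2)
      by (simp add: F_def x z pmf_map_graph_pmf_of_set edge_def)
  qed
  have out_range: "F (Suc i) = of_bool (x = z)" if "length ?inc \<le> i" for i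
    using that by (simp add: F_def equ_oracle_def x pmf_return indicator_def)
  have "pmf (cover_step orc d x) z = (\<Sum>i\<in>{1..d}. F i) / d"
    unfolding cover_step_def x case_prod_conv F_def using d
    by (subst pmf_bind_pmf_of_set) auto
  also have "(\<Sum>i\<in>{1..d}. F i) = (\<Sum>i<d. F (Suc i))"
    using sum.atLeast1_atMost_eq[of F d] by simp
  also have "\<dots> = (\<Sum>i<length ?inc. F (Suc i)) + (\<Sum>i=length ?inc..<d. F (Suc i))"
    using incident(3)[of u] by (simp add: lessThan_atLeast0 sum.atLeastLessThan_concat)
  also have "(\<Sum>i<length ?inc. F (Suc i)) = (\<Sum>i<length ?inc. edge (?inc ! i) x z)"
    by (intro sum.cong) (simp_all add: in_range)
  also have "\<dots> = (\<Sum>j\<in>set ?inc. edge j x z)"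
    using sum.reindex_bij_betw[OF bij_betw_nth[OF incident(1)[of u] refl refl], of "\<lambda>j. edge j x z"] by simp
  also have "\<dots> = (\<Sum>j<M. edge j x z)"
    unfolding incident(2) by (intro sum.mono_neutral_left) (auto simp: edge_def x)
  also have "(\<Sum>i=length ?inc..<d. F (Suc i)) = (d - length ?inc) * of_bool (x = z)"
    by (simp add: out_range)
  finally show ?thesis by (simp add: x)
qed

text \<open>The degree of the start only enters through the self-loop term, which vanishes unless
  \<open>x = z\<close>.\<close>

lemma cover_step_sym: "pmf (cover_step orc d x) z = pmf (cover_step orc d z) x"
  by (auto simp: pmf_cover_step edge_sym[of _ x z])

lemma edges_le_cover_step: "(\<Sum>j<M. edge j x z) \<le> d * pmf (cover_step orc d x) z"
  using d by (simp add: pmf_cover_step)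

section \<open>The cover walk as a doubly stochastic chain and its biases\<close>

definition \<Omega> :: "(nat \<times> bit) set" where "\<Omega> = {..<n} \<times> UNIV"

lemma \<Omega>: "finite \<Omega>" "\<Omega> \<noteq> {}" "card \<Omega> = 2 * n"
  using n by (auto simp: \<Omega>_def card_cartesian_product UNIV_bit)

lemma sum_\<Omega>: "(\<Sum>y\<in>\<Omega>. f y) = (\<Sum>s<n. f (s, 0) + f (s, 1))" for f :: "_ \<Rightarrow> real"
  unfolding \<Omega>_def sum.cartesian_product' by (simp add: UNIV_bit)

lemma set_cover_step: "x \<in> \<Omega> \<Longrightarrow> set_pmf (cover_step orc d x) \<subseteq> \<Omega>"
proof
  fix z assume x: "x \<in> \<Omega>" and "z \<in> set_pmf (cover_step orc d x)"
  then have "pmf (cover_step orc d x) z \<noteq> 0" by (simp add: set_pmf_eq)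
  then have "x \<noteq> z \<Longrightarrow> (\<Sum>j<M. edge j x z) \<noteq> 0" by (simp add: pmf_cover_step)
  then consider j where "j < M" "edge j x z \<noteq> 0" | "x = z"
    by (meson lessThan_iff sum.not_neutral_contains_not_neutral)
  then show "z \<in> \<Omega>"
  proof cases
    case 1
    then show ?thesis using V(1)[of j] by (cases z) (auto simp: edge_def \<Omega>_def)
  qed (use x in simp)
qed

lemma set_W: "x \<in> \<Omega> \<Longrightarrow> set_pmf (W l x) \<subseteq> \<Omega>"
proof (induction l arbitrary: x)
  case (Suc l)
  then show ?case using set_cover_step[OF Suc.prems] unfolding cover_walk.simps set_bind_pmf by blast
qed simp

lemma W_smooth:
  fixes \<alpha> :: real and L :: nat
  assumes "0 < \<alpha>" "0 < L"
  obtains l where "l < L"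
    "(\<Sum>x\<in>\<Omega>. \<Sum>z\<in>\<Omega>. pmf (cover_step orc d x) z * (\<Sum>y\<in>\<Omega>. \<bar>pmf (W l z) y - pmf (W (Suc l) x) y\<bar>))
      \<le> 2 * real n * (ln (2 * real n) / (2 * \<alpha> * real L) + 2 * \<alpha>)"
proof (rule doubly_stochastic_walk_smooth[where A = \<Omega> and K = "\<lambda>x. pmf (cover_step orc d x)"
      and p = "\<lambda>l x. pmf (W l x)" and \<alpha> = \<alpha> and L = L])
  show "(\<Sum>z\<in>\<Omega>. pmf (cover_step orc d x) z) = 1" if "x \<in> \<Omega>" for x
    using set_cover_step[OF that] \<Omega>(1) by (simp add: sum_pmf_eq_1)
  show "(\<Sum>x\<in>\<Omega>. pmf (cover_step orc d x) z) = 1" if "z \<in> \<Omega>" for z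
    using set_cover_step[OF that] \<Omega>(1) by (simp add: cover_step_sym[of _ z] sum_pmf_eq_1)
  show "(\<Sum>y\<in>\<Omega>. pmf (W l x) y) = 1" if "x \<in> \<Omega>" for l x
    using set_W[OF that] \<Omega>(1) by (simp add: sum_pmf_eq_1)
  show "pmf (W (Suc l) x) y = (\<Sum>z\<in>\<Omega>. pmf (cover_step orc d x) z * pmf (W l z) y)" if "x \<in> \<Omega>" for l x y
    using set_cover_step[OF that] \<Omega>(1)
    by (simp add: pmf_bind) (subst integral_measure_pmf[of \<Omega>], auto)
qed (use that \<Omega> assms in auto)

text \<open>The offset as a real sign. If no variable of the constraint has both offsets, a sign
  assignment \<open>x\<close> satisfies it iff \<open>tau j v * x v\<close> is constant in
  \<open>v\<close>.\<close>

definition tau :: "nat \<Rightarrow> nat \<Rightarrow> real" where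
  "tau j v = (if offset (con j) v = 0 then 1 else -1)"

lemma tau_cases: "tau j v = 1 \<or> tau j v = -1" by (simp add: tau_def)

text \<open>Multiplication by \<open>tau j u\<close> inside the absolute value leaves the sign
  \<open>tau j u * tau j v\<close>, which \<open>bias_cover_walk_1\<close> turns into the sheet that
  a step from \<open>(u, 0)\<close> to \<open>v\<close> reaches.\<close>

lemma bias_tau: "\<bar>tau j v * bias (W l (v, 0)) s - tau j u * q\<bar>
   = \<bar>bias (W l (v, offset (con j) u + offset (con j) v)) s - q\<bar>"
  by (cases "offset (con j) u"; cases "offset (con j) v") (auto simp: tau_def bias_cover_walk_1)

lemma sum_bias_diff_le:
  "(\<Sum>s<n. \<bar>bias p s - bias q s\<bar>) \<le> (\<Sum>y\<in>\<Omega>. \<bar>pmf p y - pmf q y\<bar>)"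
  unfolding sum_\<Omega> bias_def by (intro sum_mono) linarith

text \<open>From \<open>\<bar>a - b\<bar> = a + b - 2 * min a b\<close>, the sum equals
  \<open>1 - 2 * overlap\<close>.\<close>

lemma bias_mass:
  assumes "x \<in> \<Omega>" "overlap n (W l x) < 1 / 8"
  shows "3 / 4 \<le> (\<Sum>s<n. \<bar>bias (W l x) s\<bar>)"
proof -
  have "(\<Sum>s<n. \<bar>bias (W l x) s\<bar>) = (\<Sum>y\<in>\<Omega>. pmf (W l x) y) - 2 * overlap n (W l x)"
    unfolding overlap_def sum_\<Omega> sum_distrib_left sum_subtractf[symmetric]
    by (intro sum.cong) (auto simp: bias_def)
  then show ?thesis using assms set_W[OF assms(1), of l] \<Omega>(1) by (simp add: sum_pmf_eq_1)
qed

text \<open>Bad for rounding, but exactly the start variables from which a round has a constant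
  chance to reject.\<close>

definition bad :: "nat \<Rightarrow> nat set" where
  "bad l = {u. u < n \<and> ((\<exists>i\<in>{1..d}. \<exists>c. orc u i = Some c \<and> (\<nexists>\<sigma>. sat_constraint k \<sigma> c))
      \<or> 1 / 8 \<le> overlap n (W l (u, 0)))}"

lemma card_touching:
  assumes "finite B" shows "card {j. j < M \<and> V j \<inter> B \<noteq> {}} \<le> d * card B"
proof -
  have "{j. j < M \<and> V j \<inter> B \<noteq> {}} = (\<Union>u\<in>B. set (incident I u))" unfolding incident(2) by auto
  also have "card \<dots> \<le> (\<Sum>u\<in>B. card (set (incident I u)))" using assms by (rule card_UN_le)
  also have "\<dots> \<le> (\<Sum>u\<in>B. d)"
    by (intro sum_mono order_trans[OF card_length incident(3)])
  finally show ?thesis by (simp add: mult.commute)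
qed

lemma offset_unique:
  assumes "sat_constraint k \<sigma> c" "(v, b) \<in> set c" shows "b = offset c v"
proof -
  have "v \<in> constraint_vars c" using assms(2) by (force simp: constraint_vars_def)
  then have "\<sigma> v + b = \<sigma> v + offset c v"
    using assms(1) imageI[OF offset_in, of v c "\<lambda>(x, b). \<sigma> x + b"]
      imageI[OF assms(2), of "\<lambda>(x, b). \<sigma> x + b"]
    unfolding sat_constraint_def equ_def set_map case_prod_conv by blast
  then show ?thesis by (simp only: add_left_cancel)
qed

text \<open>Deleting the constraints that touch \<open>bad l\<close> and those violated by the
  rounded biases leaves a satisfiable instance. The former number at most
  \<open>d * card (bad l)\<close>, the latter at most a quarter of \<open>\<delta> * d * n\<close>,
  so farness forces \<open>bad l\<close> to be large.\<close>

lemma far_imp_many_bad: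
  fixes \<delta> :: real and L :: nat
  assumes \<delta>: "0 < \<delta>" and L: "0 < L" "1024 * ln (2 * real n) / \<delta>\<^sup>2 \<le> L"
    and far: "\<And>R. R \<subseteq> {..<M} \<Longrightarrow> satisfiable_without k R I \<Longrightarrow> \<delta> * d * n \<le> card R"
  obtains l where "l < L" "\<delta> * n / 2 \<le> card (bad l)"
proof -
  \<comment> \<open>With this choice \<open>2 * \<alpha>\<close> is \<open>\<delta> / 32\<close>,
    and the lower bound on \<open>L\<close> brings the entropy term below the same value.\<close>
  define \<alpha> where "\<alpha> = \<delta> / 64"
  define D where "D l x z = (\<Sum>y\<in>\<Omega>. \<bar>pmf (W l z) y - pmf (W (Suc l) x) y\<bar>)" for l x z
  have "0 < \<alpha>" using \<delta> by (simp add: \<alpha>_def)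
  from W_smooth[OF this L(1)] obtain l where l: "l < L"
    and smooth: "(\<Sum>x\<in>\<Omega>. \<Sum>z\<in>\<Omega>. pmf (cover_step orc d x) z * D l x z)
      \<le> 2 * real n * (ln (2 * real n) / (2 * \<alpha> * real L) + 2 * \<alpha>)"
    unfolding D_def by blast
  have D_nonneg: "0 \<le> D l x z" for x z by (simp add: D_def sum_nonneg)
  have "ln (2 * real n) / (2 * \<alpha> * real L) \<le> \<delta> / 32"
    using L \<delta> by (simp add: \<alpha>_def field_simps power2_eq_square)
  then have "2 * real n * (ln (2 * real n) / (2 * \<alpha> * real L) + 2 * \<alpha>) \<le> 2 * real n * (\<delta> / 32 + \<delta> / 32)"
    by (intro mult_left_mono) (auto simp: \<alpha>_def)
  also have "\<dots> = n * \<delta> / 8" by simp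
  finally have smooth: "(\<Sum>x\<in>\<Omega>. \<Sum>z\<in>\<Omega>. pmf (cover_step orc d x) z * D l x z) \<le> n * \<delta> / 8"
    using smooth by linarith
  define U where "U = {..<n} - bad l"
  define J where "J = {j. j < M \<and> V j \<subseteq> U}"
  define Q where "Q v = bias (W l (v, 0))" for v
  define \<Delta> where "\<Delta> j u = (\<Sum>z\<in>\<Omega>. edge j (u, 0) z * D l (u, 0) z)" for j u
  define w where "w j = 4 / 3 * (\<Sum>u\<in>V j. \<Delta> j u)" for j
  have \<Delta>_nonneg: "0 \<le> \<Delta> j u" for j u
    using D_nonneg edge_nonneg by (auto simp: \<Delta>_def intro!: sum_nonneg)
  \<comment> \<open>Any variable \<open>u\<close> of the constraint can serve as center: its
    next-step bias is the reference vector, and the moves from \<open>u\<close> through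
    \<open>j\<close> reach the variables of \<open>j\<close> with equal weight
    \<open>1 / card (V j)\<close>.\<close>
  have \<Delta>_eq: "(\<Sum>s<n. \<Sum>v\<in>V j. \<bar>tau j v * Q v s - tau j u * bias (W (Suc l) (u, 0)) s\<bar>) \<le> card (V j) * \<Delta> j u"
    if j: "j < M" and u: "u \<in> V j" for j u
  proof -
    let ?z = "\<lambda>v. (v, offset (con j) u + offset (con j) v)"
    have "(\<Sum>s<n. \<Sum>v\<in>V j. \<bar>tau j v * Q v s - tau j u * bias (W (Suc l) (u, 0)) s\<bar>)
        = (\<Sum>v\<in>V j. \<Sum>s<n. \<bar>bias (W l (?z v)) s - bias (W (Suc l) (u, 0)) s\<bar>)"
      unfolding Q_def bias_tau by (rule sum.swap)
    also have "\<dots> \<le> (\<Sum>v\<in>V j. D l (u, 0) (?z v))"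
      unfolding D_def by (intro sum_mono sum_bias_diff_le)
    also have "\<dots> = (\<Sum>z\<in>?z ` V j. D l (u, 0) z)"
      by (subst sum.reindex) (auto simp: inj_on_def)
    also have "\<dots> = (\<Sum>z\<in>?z ` V j. card (V j) * (edge j (u, 0) z * D l (u, 0) z))"
      using u V(2)[OF j] V(3)[of j] by (intro sum.cong) (auto simp: edge_def)
    also have "\<dots> \<le> (\<Sum>z\<in>\<Omega>. card (V j) * (edge j (u, 0) z * D l (u, 0) z))"
      using V(1)[OF j] D_nonneg edge_nonneg by (intro sum_mono2 \<Omega>) (auto simp: \<Omega>_def)
    finally show ?thesis by (simp add: \<Delta>_def sum_distrib_left)
  qed
  \<comment> \<open>The best center does no worse than the average one, which removes the factor
    \<open>card (V j)\<close>.\<close>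
  have ex_r: "\<exists>r. (\<Sum>s<n. \<Sum>v\<in>V j. \<bar>tau j v * Q v s - r s\<bar>) \<le> 3 / 4 * w j" if j: "j < M" for j
  proof (rule ccontr)
    assume "\<not> ?thesis"
    then have "3 / 4 * w j < card (V j) * \<Delta> j u" if "u \<in> V j" for u
      using \<Delta>_eq[OF j that] by (meson not_le order_less_le_trans)
    then have "(\<Sum>u\<in>V j. 3 / 4 * w j) < (\<Sum>u\<in>V j. card (V j) * \<Delta> j u)"
      using V(2)[OF j] V(3)[of j] by (intro sum_strict_mono) auto
    then show False by (simp add: w_def flip: sum_distrib_left)
  qed
  define r where "r j = (SOME r. (\<Sum>s<n. \<Sum>v\<in>V j. \<bar>tau j v * Q v s - r s\<bar>) \<le> 3 / 4 * w j)" for j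
  have r: "(\<Sum>s<n. \<Sum>v\<in>V j. \<bar>tau j v * Q v s - r j s\<bar>) \<le> 3 / 4 * w j" if "j < M" for j
    unfolding r_def by (rule someI_ex[OF ex_r[OF that]])
  \<comment> \<open>The slack contributes at most \<open>d * n * \<delta> / 12\<close>, which
    together with the total weight \<open>d * n * \<delta> / 6\<close> gives
    \<open>d * n * \<delta> / 4\<close>.\<close>
  have "\<exists>x :: nat \<Rightarrow> real. (\<forall>u\<in>U. x u = 1 \<or> x u = -1) \<and>
    card {j \<in> J. \<not> (\<exists>e. \<forall>v\<in>V j. tau j v * x v = e)} \<le> (\<Sum>j\<in>J. w j) + (d * \<delta> / 12) * card U"
  proof (rule signed_rounding[where Q = Q and X = "{..<n}" and c = "3 / 4" and r = r])
    show "3 / 4 \<le> (\<Sum>s<n. \<bar>Q u s\<bar>)" if "u \<in> U" for u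
      unfolding Q_def using that by (intro bias_mass) (auto simp: U_def bad_def \<Omega>_def)
    show "(\<Sum>s<n. \<Sum>v\<in>V j. \<bar>tau j v * Q v s - r j s\<bar>) \<le> 3 / 4 * w j" if "j \<in> J" for j
      using that by (intro r) (simp add: J_def)
    show "V j \<noteq> {} \<and> V j \<subseteq> U" if "j \<in> J" for j using that V(2) by (simp add: J_def)
    show "\<bar>Q u s\<bar> \<le> 1" for u s unfolding Q_def by (rule abs_bias_le_1)
    show "0 \<le> w j" for j using \<Delta>_nonneg by (simp add: w_def sum_nonneg)
    show "tau j v = 1 \<or> tau j v = -1" for j v by (rule tau_cases)
    show "0 < real d * \<delta> / 12" using d \<delta> by simp
  qed (simp_all add: U_def J_def)
  then obtain x :: "nat \<Rightarrow> real" where x: "\<And>u. u \<in> U \<Longrightarrow> x u = 1 \<or> x u = -1"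
    "card {j \<in> J. \<not> (\<exists>e. \<forall>v\<in>V j. tau j v * x v = e)} \<le> (\<Sum>j\<in>J. w j) + (d * \<delta> / 12) * card U"
    by blast
  have "(\<Sum>j\<in>J. w j) \<le> d * n * \<delta> / 6"
  proof -
    have "(\<Sum>j\<in>J. w j) \<le> (\<Sum>j<M. w j)"
      using \<Delta>_nonneg by (intro sum_mono2) (auto simp: J_def w_def intro!: sum_nonneg)
    also have "\<dots> = 4 / 3 * (\<Sum>j<M. \<Sum>u\<in>V j. \<Delta> j u)" by (simp add: w_def sum_distrib_left)
    also have "(\<Sum>j<M. \<Sum>u\<in>V j. \<Delta> j u) \<le> (\<Sum>j<M. \<Sum>u<n. \<Delta> j u)"
      using V \<Delta>_nonneg by (intro sum_mono sum_mono2) auto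
    also have "\<dots> = (\<Sum>u<n. \<Sum>z\<in>\<Omega>. (\<Sum>j<M. edge j (u, 0) z) * D l (u, 0) z)"
      unfolding \<Delta>_def sum_distrib_right
      by (subst sum.swap) (intro sum.cong refl sum.swap)
    also have "\<dots> \<le> (\<Sum>u<n. \<Sum>z\<in>\<Omega>. (d * pmf (cover_step orc d (u, 0)) z) * D l (u, 0) z)"
      using D_nonneg by (intro sum_mono mult_right_mono edges_le_cover_step) auto
    also have "\<dots> \<le> (\<Sum>x\<in>\<Omega>. \<Sum>z\<in>\<Omega>. (d * pmf (cover_step orc d x) z) * D l x z)"
      unfolding sum_\<Omega>[of "\<lambda>x. \<Sum>z\<in>\<Omega>. _ x z"] using D_nonneg by (intro sum_mono) (simp add: sum_nonneg)
    also have "\<dots> = d * (\<Sum>x\<in>\<Omega>. \<Sum>z\<in>\<Omega>. pmf (cover_step orc d x) z * D l x z)"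
      by (simp add: sum_distrib_left mult.assoc)
    also have "\<dots> \<le> d * (n * \<delta> / 8)" using smooth by (intro mult_left_mono) auto
    finally show ?thesis by (simp add: mult_ac)
  qed
  moreover have "(d * \<delta> / 12) * card U \<le> (d * \<delta> / 12) * n"
  proof -
    have "card U \<le> card {..<n}" unfolding U_def by (intro card_mono) auto
    then show ?thesis using \<delta> by (intro mult_left_mono) auto
  qed
  ultimately have viol: "card {j \<in> J. \<not> (\<exists>e. \<forall>v\<in>V j. tau j v * x v = e)} \<le> d * n * \<delta> / 4"
    using x(2) by (simp add: algebra_simps)
  define R1 where "R1 = {j. j < M \<and> V j \<inter> bad l \<noteq> {}}"
  define R2 where "R2 = {j \<in> J. \<not> (\<exists>e. \<forall>v\<in>V j. tau j v * x v = e)}"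
  have "satisfiable_without k (R1 \<union> R2) I"
    unfolding satisfiable_without_def
  \<comment> \<open>The sign 1 becomes the bit 0. The surviving constraints contain no bad variable,
    so each is satisfiable by itself and its offsets are unambiguous.\<close>
  proof (intro exI[of _ "\<lambda>v. if x v = 1 then 0 else 1"] allI impI)
    fix j assume j: "j < M" "j \<notin> R1 \<union> R2"
    then have VU: "V j \<subseteq> U" using V(1)[OF j(1)] by (auto simp: U_def R1_def)
    then obtain e where e: "\<And>v. v \<in> V j \<Longrightarrow> tau j v * x v = e" using j by (auto simp: R2_def J_def)
    obtain u where u: "u \<in> V j" using V(2)[OF j(1)] by blast
    have "u < n" "u \<notin> bad l" using u VU by (auto simp: U_def)
    then obtain \<sigma>0 where \<sigma>0: "sat_constraint k \<sigma>0 (con j)"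
      using orc_ex[OF j(1) u] unfolding bad_def by blast
    have *: "(if x v = 1 then 0 else 1) + b = (if e = 1 then 0 else 1 :: bit)" if "(v, b) \<in> set (con j)" for v b
    proof -
      have v: "v \<in> V j" using that by (force simp: constraint_vars_def)
      have "b = offset (con j) v" using offset_unique[OF \<sigma>0 that] .
      then show ?thesis using e[OF v] x(1)[of v] v VU by (cases b) (auto simp: tau_def)
    qed
    have "length (con j) = k" using \<sigma>0 by (simp add: sat_constraint_def equ_def)
    then show "sat_constraint k (\<lambda>v. if x v = 1 then 0 else 1) (con j)"
      using * by (fastforce simp: sat_constraint_def equ_def)
  qed
  then have "\<delta> * d * n \<le> card (R1 \<union> R2)"
    by (intro far) (auto simp: R1_def R2_def J_def)
  also have "\<dots> \<le> card R1 + card R2" using card_Un_le[of R1 R2] by simp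
  also have "\<dots> \<le> d * card (bad l) + d * n * \<delta> / 4"
    using viol card_touching[of "bad l"] unfolding R1_def[symmetric] R2_def[symmetric]
    by (simp add: bad_def flip: of_nat_mult)
  finally have "d * (\<delta> * n * 3 / 4) \<le> d * card (bad l)" by (simp add: algebra_simps)
  then have "\<delta> * n * 3 / 4 \<le> card (bad l)" using d by simp
  then show ?thesis using \<delta> by (intro that[OF l]) linarith
qed

text \<open>A round lowers the acceptance bound by the factor \<open>1 - \<rho>\<close> with
  \<open>\<rho> \<ge> \<delta> / (4 * L)\<close>. Hence \<open>R * \<rho> \<ge> 2\<close>, and
  \<open>exp (- 2) \<le> 1 / 3\<close>.\<close>

lemma accept_tester_far:
  fixes \<delta> :: real and L :: nat
  assumes \<delta>: "0 < \<delta>" and L: "0 < L" "1024 * ln (2 * real n) / \<delta>\<^sup>2 \<le> L"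
    and m: "80 * sqrt n \<le> m" and R: "8 * real L / \<delta> \<le> R"
    and far: "\<And>R. R \<subseteq> {..<M} \<Longrightarrow> satisfiable_without k R I \<Longrightarrow> \<delta> * d * n \<le> card R"
  shows "accept orc (tester k n d L m R) \<le> 1 / 3"
proof -
  obtain l where l: "l < L" "\<delta> * n / 2 \<le> card (bad l)"
    using far_imp_many_bad[OF \<delta> L far] by blast
  define \<rho> where "\<rho> = real (card (bad l)) / (2 * real n * real L)"
  have "accept orc (tester k n d L m R) \<le> (1 - \<rho>) ^ R"
    unfolding \<rho>_def
  proof (rule accept_tester_le[OF _ n m l(1)])
    show "x \<in> constraint_vars c" if "orc x i = Some c" for x i c
      using orc_SomeD[OF that] by blast
  qed (auto simp: bad_def)
  also have "\<dots> \<le> exp (- \<rho>) ^ R"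
  proof (rule power_mono)
    show "1 - \<rho> \<le> exp (- \<rho>)" using exp_ge_add_one_self[of "- \<rho>"] by simp
    have "card (bad l) \<le> card {..<n}" by (intro card_mono) (auto simp: bad_def)
    then have "real (card (bad l)) \<le> real n * 1" by simp
    also have "\<dots> \<le> real n * (2 * real L)" using L by (intro mult_left_mono) auto
    finally show "0 \<le> 1 - \<rho>" using n L by (simp add: \<rho>_def divide_le_eq mult_ac)
  qed
  also have "\<dots> = exp (- (R * \<rho>))" by (simp flip: exp_of_nat_mult)
  also have "\<dots> \<le> exp (- 2)"
  proof -
    have "\<delta> / (4 * L) \<le> \<rho>" using l(2) n L by (simp add: \<rho>_def field_simps)
    then have "(8 * L / \<delta>) * (\<delta> / (4 * L)) \<le> R * \<rho>" using R \<delta> by (intro mult_mono) auto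
    then show ?thesis using \<delta> L by simp
  qed
  also have "\<dots> \<le> 1 / 3" using exp_ge_add_one_self[of 2] by (simp add: exp_minus field_simps)
  finally show ?thesis .
qed

lemma M_le: "M \<le> d * n"
proof -
  have "{j. j < M \<and> V j \<inter> {..<n} \<noteq> {}} = {..<M}" using V(1,2) by blast
  then show ?thesis using card_touching[of "{..<n}"] by simp
qed

lemma tester_runs_within:
  assumes "0 < L"
  shows "runs_within orc (satisfiable k I) (R * (d + 2 * m * L)) (tester k n d L m R)"
proof (rule runs_within_tester[where C = "set (constrs I)", OF _ assms])
  show "c \<in> set (constrs I)" if "orc x i = Some c" for x i c
    using orc_SomeD[OF that] nth_mem by blast
  show "\<exists>\<sigma>. \<forall>c\<in>set (constrs I). sat_constraint k \<sigma> c" if "satisfiable k I"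
    using that unfolding satisfiable_def satisfiable_without_def by (metis empty_iff in_set_conv_nth)
qed

end

section \<open>Choice of parameters and the final bounds\<close>

lemma prob_reject_eq: "prob_reject A I = 1 - accept (equ_oracle I) A"
proof -
  have "{(b, q). \<not> b} = UNIV - {(b :: bool, q :: nat). b}" by auto
  then show ?thesis
    unfolding prob_reject_def accept_def
    using measure_pmf.prob_compl[of "{(b, q). b}" "run_alg (equ_oracle I) A"] by simp
qed

lemma prob_accept_eq_1:
  assumes "runs_within (equ_oracle I) True N A" shows "prob_accept A I = 1"
  unfolding prob_accept_def
  using assms by (subst measure_pmf.prob_eq_1) (auto simp: AE_measure_pmf_iff runs_within_def)

text \<open>Everything is measured in \<open>x = d * ln n / \<delta>\<close>: \<open>L\<close> is of
  order \<open>x ^ 3\<close>, \<open>R\<close> of order \<open>x ^ 4\<close> and \<open>m\<close> of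
  order \<open>sqrt n\<close>. As \<open>n \<ge> 2\<close> gives \<open>x \<ge> 1 / 2\<close>,
  additive constants can be absorbed into powers of \<open>x\<close>.\<close>

lemma query_bound:
  fixes \<delta> :: real and d n :: nat
  assumes \<delta>: "0 < \<delta>" "\<delta> \<le> 1" and d: "1 \<le> d" and n: "2 \<le> n"
    and L: "L = nat \<lceil>1024 * ln (2 * real n) / \<delta>\<^sup>2\<rceil>"
    and m: "m = nat \<lceil>80 * sqrt n\<rceil>" and R: "R = nat \<lceil>8 * real L / \<delta>\<rceil>"
  shows "real (R * (d + 2 * m * L)) \<le> 131216 * 1328408 * (sqrt n * (d * ln n / \<delta>) ^ 7)"
proof -
  define x where "x = d * ln n / \<delta>"
  have ln_n: "1 / 2 \<le> ln n"
  proof -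
    have "1 / 2 \<le> ln (2 :: real)" using ln2_ge_two_thirds by simp
    also have "\<dots> \<le> ln n" using n by simp
    finally show ?thesis .
  qed
  have inv: "1 \<le> 1 / \<delta>" using \<delta> by simp
  have "1 * (1 / 2) * (1 / \<delta>) \<le> d * ln n * (1 / \<delta>)"
    using ln_n d \<delta> by (intro mult_mono) auto
  then have inv_le: "1 / \<delta> \<le> 2 * x" by (simp add: x_def)
  then have x: "1 / 2 \<le> x" using inv by linarith
  have "d * (1 / 2) * 1 \<le> d * ln n * (1 / \<delta>)" using ln_n inv by (intro mult_mono) auto
  then have d_le: "d \<le> 2 * x" by (simp add: x_def mult_ac)
  have "1 * ln n * 1 \<le> d * ln n * (1 / \<delta>)" using ln_n inv d by (intro mult_mono) auto
  then have ln_le: "ln n \<le> x" by (simp add: x_def)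
  have pow: "1 \<le> 8 * x ^ 3" "1 \<le> 16 * x ^ 4" "2 * x \<le> 8 * x ^ 3"
  proof -
    have "1 ^ 3 \<le> (2 * x) ^ 3" "1 ^ 4 \<le> (2 * x) ^ 4" using x by (intro power_mono; simp)+
    then show "1 \<le> 8 * x ^ 3" "1 \<le> 16 * x ^ 4" by (simp_all add: power_mult_distrib)
    have "(2 * x) ^ 1 \<le> (2 * x) ^ 3" using x by (intro power_increasing) auto
    then show "2 * x \<le> 8 * x ^ 3" by (simp add: power_mult_distrib)
  qed
  have sqrt: "1 \<le> sqrt n" using n by simp
  have "ln (2 * real n) \<le> 2 * x"
  proof -
    have "ln (2 * real n) \<le> ln (real n * real n)" using n by (subst ln_le_cancel_iff) auto
    also have "\<dots> = 2 * ln n" using n by (simp add: ln_mult)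
    finally show ?thesis using ln_le by simp
  qed
  then have "1024 * ln (2 * real n) * (1 / \<delta>) ^ 2 \<le> 1024 * (2 * x) * (2 * x) ^ 2"
    using inv inv_le x n \<delta> by (intro mult_mono power_mono) auto
  then have "1024 * ln (2 * real n) / \<delta>\<^sup>2 \<le> 8192 * x ^ 3"
    by (simp add: power_divide power_mult_distrib power2_eq_square power3_eq_cube)
  \<comment> \<open>The extra 8 absorbs the rounding up, since \<open>1 \<le> 8 * x ^ 3\<close>;
    likewise 131216 below is 131200 + 16.\<close>
  then have L_le: "real L \<le> 8200 * x ^ 3"
    using pow(1) of_int_ceiling_le_add_one[of "1024 * ln (2 * real n) / \<delta>\<^sup>2"] n
    unfolding L by simp linarith
  have "8 * real L * (1 / \<delta>) \<le> 8 * (8200 * x ^ 3) * (2 * x)"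
    using L_le inv inv_le x \<delta> by (intro mult_mono) auto
  then have "8 * real L / \<delta> \<le> 131200 * x ^ 4" by (simp add: power3_eq_cube power4_eq_xxxx)
  then have R_le: "real R \<le> 131216 * x ^ 4"
    using pow(2) of_int_ceiling_le_add_one[of "8 * real L / \<delta>"] \<delta>
    unfolding R by simp linarith
  have m_le: "real m \<le> 81 * sqrt n"
  proof -
    have "real m = real_of_int \<lceil>80 * sqrt n\<rceil>" by (simp add: m)
    then show ?thesis using sqrt of_int_ceiling_le_add_one[of "80 * sqrt n"] by linarith
  qed
  have "2 * real m * real L \<le> 2 * (81 * sqrt n) * (8200 * x ^ 3)"
    using m_le L_le sqrt by (intro mult_mono) auto
  moreover have "real d \<le> sqrt n * (8 * x ^ 3)"
    using d_le pow sqrt mult_right_mono[of 1 "sqrt n" "8 * x ^ 3"] by linarith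
  \<comment> \<open>The constant is \<open>2 * 81 * 8200 + 8\<close>.\<close>
  ultimately have "real (d + 2 * m * L) \<le> 1328408 * (sqrt n * x ^ 3)"
    by (simp add: algebra_simps)
  then have "real R * real (d + 2 * m * L) \<le> (131216 * x ^ 4) * (1328408 * (sqrt n * x ^ 3))"
    using R_le x by (intro mult_mono) auto
  also have "\<dots> = 131216 * 1328408 * (sqrt n * (x ^ 4 * x ^ 3))" by (simp only: mult_ac)
  finally show ?thesis by (simp add: x_def flip: power_add)
qed

text \<open>The farness bound \<open>\<epsilon> * d * n / k\<close> is
  \<open>\<delta> * d * n\<close> for \<open>\<delta> = \<epsilon> / k\<close>, which explains the
  parameters.\<close>

lemma eps_tester_constants:
  fixes \<epsilon> :: real and d k n :: nat
  assumes \<epsilon>: "0 < \<epsilon>" "\<epsilon> \<le> k" and d: "1 \<le> d" and k: "2 \<le> k" and n: "1 \<le> n"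
    and L: "L = nat \<lceil>1024 * ln (2 * real n) / (\<epsilon> / k)\<^sup>2\<rceil>"
    and m: "m = nat \<lceil>80 * sqrt n\<rceil>" and R: "R = nat \<lceil>8 * real L / (\<epsilon> / k)\<rceil>"
  shows "eps_tester \<epsilon> k d n (tester k n d L m R)" "one_sided k d n (tester k n d L m R)"
    "query_complexity_le k d n (tester k n d L m R) (R * (d + 2 * m * L))"
proof -
  define \<delta> where "\<delta> = \<epsilon> / k"
  have \<delta>: "0 < \<delta>" using \<epsilon> k by (simp add: \<delta>_def)
  have "0 < ln (2 * real n)" using n by simp
  then have "0 < 1024 * ln (2 * real n) / (\<epsilon> / k)\<^sup>2"
    using \<delta> unfolding \<delta>_def[symmetric] by (intro divide_pos_pos) simp_all
  then have L0: "0 < L" by (simp add: L)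
  have L': "1024 * ln (2 * real n) / \<delta>\<^sup>2 \<le> L" unfolding L \<delta>_def by (rule real_nat_ceiling_ge)
  have m': "80 * sqrt n \<le> m" unfolding m by (rule real_nat_ceiling_ge)
  have R': "8 * real L / \<delta> \<le> R" unfolding R \<delta>_def by (rule real_nat_ceiling_ge)
  let ?A = "tester k n d L m R"
  have walk: "instance_walk I k d n" if "I \<in> equ_insts k d n" for I
    using that d k n by unfold_locales auto
  have runs: "runs_within (equ_oracle I) (satisfiable k I) (R * (d + 2 * m * L)) ?A"
    if "I \<in> equ_insts k d n" for I
    using instance_walk.tester_runs_within[OF walk[OF that] L0] .
  have acc: "prob_accept ?A I = 1" if "I \<in> equ_insts k d n" "satisfiable k I" for I
    using runs[OF that(1)] that(2) prob_accept_eq_1 by simp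
  have "2 / 3 \<le> prob_reject ?A I" if I: "I \<in> equ_insts k d n" "eps_far \<epsilon> k d n I" for I
  proof -
    have "\<delta> * d * n \<le> card R" if "R \<subseteq> {..<length (constrs I)}" "satisfiable_without k R I" for R
      using I(2) that by (simp add: eps_far_def \<delta>_def)
    then have "accept (equ_oracle I) ?A \<le> 1 / 3"
      by (intro instance_walk.accept_tester_far[OF walk[OF I(1)] \<delta> L0 L' m' R'])
    then show ?thesis by (simp add: prob_reject_eq)
  qed
  then show "eps_tester \<epsilon> k d n ?A" using acc by (simp add: eps_tester_def)
  show "one_sided k d n ?A" using acc by (simp add: one_sided_def)
  show "query_complexity_le k d n ?A (R * (d + 2 * m * L))"
    unfolding query_complexity_le_def
  proof (intro ballI)
    fix I x assume "I \<in> equ_insts k d n" "x \<in> set_pmf (run_alg (equ_oracle I) ?A)"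
    then show "case x of (b, q) \<Rightarrow> real q \<le> real (R * (d + 2 * m * L))"
      using runs[of I] unfolding runs_within_def by (metis (mono_tags, lifting) case_prodD case_prodI2 of_nat_mono)
  qed
qed

text \<open>Removing all constraints always suffices, and the degree bound allows at most
  \<open>d * n\<close> of them, fewer than \<open>\<epsilon> * d * n / k\<close>.\<close>

lemma not_eps_far:
  assumes "real k < \<epsilon>" "1 \<le> d" "2 \<le> k" "1 \<le> n" "I \<in> equ_insts k d n"
  shows "\<not> eps_far \<epsilon> k d n I"
proof
  assume far: "eps_far \<epsilon> k d n I"
  interpret instance_walk I k d n using assms by unfold_locales auto
  have "satisfiable_without k {..<M} I" by (simp add: satisfiable_without_def)
  then have "\<epsilon> * d * n / k \<le> M" using far by (auto simp: eps_far_def)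
  also have "\<dots> \<le> real d * real n" using M_le by (simp flip: of_nat_mult)
  finally have "\<epsilon> * (real d * real n) \<le> k * (real d * real n)"
    using assms by (simp add: divide_le_eq mult_ac)
  then show False using assms by simp
qed

theorem theorem4:
  "\<exists>(C::real) (p::real poly). \<forall>(\<epsilon>::real) (d::nat) (k::nat).
     \<epsilon> > 0 \<longrightarrow> d \<ge> 1 \<longrightarrow> k \<ge> 2 \<longrightarrow>
     (\<exists>A :: nat \<Rightarrow> query_alg.
        (\<forall>n\<ge>1. eps_tester \<epsilon> k d n (A n) \<and> one_sided k d n (A n)) \<and>
        (\<forall>n\<ge>2. query_complexity_le k d n (A n)
           (C * (sqrt (real n) * poly p (real d * real k * ln (real n) / \<epsilon>)))))"
proof (intro exI[of _ "131216 * 1328408 :: real"] exI[of _ "monom 1 7"] allI impI)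
  fix \<epsilon> :: real and d k :: nat
  assume \<epsilon>: "0 < \<epsilon>" and d: "1 \<le> d" and k: "2 \<le> k"
  show "\<exists>A :: nat \<Rightarrow> query_alg.
        (\<forall>n\<ge>1. eps_tester \<epsilon> k d n (A n) \<and> one_sided k d n (A n)) \<and>
        (\<forall>n\<ge>2. query_complexity_le k d n (A n)
           (131216 * 1328408 * (sqrt (real n) * poly (monom 1 7) (real d * real k * ln (real n) / \<epsilon>))))"
  proof (cases "\<epsilon> \<le> k")
    \<comment> \<open>With no far instance, accepting without any query is a tester. The other case
      provides \<open>\<epsilon> / k \<le> 1\<close>, which \<open>query_bound\<close>
      requires.\<close>
    case False
    have "prob_accept (Verdict True) I = 1" for I :: equ_inst
      by (simp add: prob_accept_def)
    then show ?thesis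
      using False \<epsilon> d k not_eps_far[of k \<epsilon> d]
      by (intro exI[of _ "\<lambda>_. Verdict True"])
        (auto simp: eps_tester_def one_sided_def query_complexity_le_def poly_monom)
  next
    case True
    define L where "L n = nat \<lceil>1024 * ln (2 * real n) / (\<epsilon> / k)\<^sup>2\<rceil>" for n
    define m where "m n = nat \<lceil>80 * sqrt (real n)\<rceil>" for n
    define R where "R n = nat \<lceil>8 * real (L n) / (\<epsilon> / k)\<rceil>" for n
    define A where "A n = tester k n d (L n) (m n) (R n)" for n
    note A = eps_tester_constants[OF \<epsilon> True d k _ L_def m_def R_def, folded A_def]
    have "query_complexity_le k d n (A n)
           (131216 * 1328408 * (sqrt (real n) * poly (monom 1 7) (real d * real k * ln (real n) / \<epsilon>)))"
      if n: "2 \<le> n" for n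
    proof -
      have "real (R n * (d + 2 * m n * L n)) \<le> 131216 * 1328408 * (sqrt n * (d * ln n / (\<epsilon> / k)) ^ 7)"
        using \<epsilon> True k by (intro query_bound d n L_def m_def R_def) auto
      also have "(d * ln n / (\<epsilon> / k)) ^ 7 = poly (monom 1 7) (real d * real k * ln (real n) / \<epsilon>)"
        by (simp add: poly_monom mult_ac)
      finally show ?thesis using A(3)[of n] n unfolding query_complexity_le_def by fastforce
    qed
    then show ?thesis using A by blast
  qed
qed

end
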